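(* Consider the Bernoulli group testing model described in the context, with an arbitrary fixed rate $R$ satisfying $\frac12<R<1$. For every $\epsilon>0$ there exists a constant $D=D(\epsilon)>0$ such that, asymptotically almost surely as $p\to+\infty$, for every $\ell\in\{0,1,\ldots,\lfloor(1-\epsilon)k\rfloor\}$, $$F_{p'}\!\left(\frac{\ell+1}{k}\right)-F_{p'}\!\left(\frac{\ell}{k}\right)\ \le\ -D\,\frac{\ln\left(\frac{p'-k}{k}\right)}{n_{\mathrm{pos}}}.$$ In particular, a.a.s. as $p\to+\infty$, $F_{p'}(\ell/k)$ is strictly decreasing as a function of $\ell\in\{0,1,2,\ldots,\lfloor(1-\epsilon)k\rfloor\}$.
   Context: Model. There are $p$ items, $k$ of which are defective; the defective set is uniformly random among $k$-subsets. One performs $n$ tests; independently over tests and items, each item is included in each test with probability $\nu/k$, where $\nu=\nu_k>0$ is the solution of $(1-\frac{\nu}{k})^k=\frac12$. A test is positive if it contains at least one defective item and negative otherwise. Asymptotics: $p\to+\infty$, with $k=k_p\to+\infty$, $k=o(p)$, and $n=n_p$ such that the rate $R=\log_2\binom{p}{k}/n$ is kept equal (up to integer rounding of $n$) to a fixed constant. A sequence of events $A_p$ holds asymptotically almost surely (a.a.s.) if $\Pr[A_p]\to1$. Let $n_{\mathrm{pos}}$ be the number of positive tests, and let $p'$ be the number of potentially defective items, i.e. items that participate in no negative test (this includes all $k$ defectives). First moment function. Let $\alpha(x,y)=x\ln\frac{x}{y}+(1-x)\ln\frac{1-x}{1-y}$ (with $0\ln 0=0$). For $\lambda\in[0,1)$,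 $F_{p'}(\lambda)$ is the unique number in $[0,1-2^{\lambda-1}]$ satisfying $$\alpha\big(F_{p'}(\lambda),1-2^{\lambda-1}\big)=\frac{\ln\left[\binom{k}{\lfloor\lambda k\rfloor}\binom{p'-k}{\lfloor(1-\lambda)k\rfloor}\right]}{n_{\mathrm{pos}}}.$$ When $\lambda=\ell/k$ the floors are $\ell$ and $k-\ell$. The existence and uniqueness of the values of $F_{p'}$ occurring in the claim is understood as part of the a.a.s. event. *)

theory Defs
  imports "HOL-Probability.Probability" "HOL-Library.Landau_Symbols"
begin

text \<open>For even \<open>k\<close> the equation has a second positive root, above \<open>k\<close>; the bound \<open>\<nu> \<le> k\<close>
  singles out the one for which \<open>\<nu> / k\<close> is a probability.\<close>

definition nu :: "nat \<Rightarrow> real" where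
  "nu k = (THE v. 0 < v \<and> v \<le> real k \<and> (1 - v / real k) ^ k = 1 / 2)"

lemma nu_ex1:
  assumes "0 < k"
  shows "\<exists>!v. 0 < v \<and> v \<le> real k \<and> (1 - v / real k) ^ k = 1 / 2"
proof (rule ex1I[of _ "real k * (1 - root k (1 / 2))"])
  have "root k (1 / 2) < 1" "0 < root k (1 / 2)" "root k (1 / 2) ^ k = 1 / 2"
    using assms by auto
  then show "0 < real k * (1 - root k (1 / 2)) \<and> real k * (1 - root k (1 / 2)) \<le> real k \<and>
    (1 - real k * (1 - root k (1 / 2)) / real k) ^ k = 1 / 2"
    using assms by (simp add: mult_le_cancel_left2)
next
  fix v assume v: "0 < v \<and> v \<le> real k \<and> (1 - v / real k) ^ k = 1 / 2"
  then have "root k ((1 - v / real k) ^ k) = 1 - v / real k"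
    using assms by (intro real_root_power_cancel) auto
  with v have "root k (1 / 2) = 1 - v / real k"
    by metis
  then show "v = real k * (1 - root k (1 / 2))"
    using assms by (simp add: field_simps)
qed

text \<open>An outcome is a pair \<open>(S, X)\<close>: the items are \<open>{..<p}\<close>, the tests are \<open>{..<n}\<close>, \<open>S\<close> is the
  defective set, and \<open>X (t, i)\<close> says that item \<open>i\<close> is included in test \<open>t\<close>.\<close>

type_synonym outcome = "nat set \<times> (nat \<times> nat \<Rightarrow> bool)"

definition bernoulli_model :: "nat \<Rightarrow> nat \<Rightarrow> nat \<Rightarrow> outcome pmf" where
  "bernoulli_model p k n =
     pair_pmf (pmf_of_set {S. S \<subseteq> {..<p} \<and> card S = k})
              (Pi_pmf ({..<n} \<times> {..<p}) False (\<lambda>_. bernoulli_pmf (nu k / real k)))"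

definition positive :: "outcome \<Rightarrow> nat \<Rightarrow> bool" where
  "positive \<omega> t \<longleftrightarrow> (\<exists>i \<in> fst \<omega>. snd \<omega> (t, i))"

definition n_pos :: "nat \<Rightarrow> outcome \<Rightarrow> nat" where
  "n_pos n \<omega> = card {t \<in> {..<n}. positive \<omega> t}"

definition potentially_defective :: "nat \<Rightarrow> nat \<Rightarrow> outcome \<Rightarrow> nat set" where
  "potentially_defective p n \<omega> = {i \<in> {..<p}. \<forall>t<n. snd \<omega> (t, i) \<longrightarrow> positive \<omega> t}"

definition p_prime :: "nat \<Rightarrow> nat \<Rightarrow> outcome \<Rightarrow> nat" where
  "p_prime p n \<omega> = card (potentially_defective p n \<omega>)"

definition alpha :: "real \<Rightarrow> real \<Rightarrow> real" where
  "alpha x y = x * ln (x / y) + (1 - x) * ln ((1 - x) / (1 - y))"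

text \<open>In the following, \<open>p'\<close> and \<open>m\<close> stand for the number of potentially defective items and the
  number of positive tests. The truncated subtraction \<open>p' - k\<close> is harmless, since every defective
  item is potentially defective.\<close>

definition num_candidates :: "nat \<Rightarrow> nat \<Rightarrow> real \<Rightarrow> nat" where
  "num_candidates k p' lam =
     (k choose nat \<lfloor>lam * real k\<rfloor>) * ((p' - k) choose nat \<lfloor>(1 - lam) * real k\<rfloor>)"

definition is_F :: "nat \<Rightarrow> nat \<Rightarrow> nat \<Rightarrow> real \<Rightarrow> real \<Rightarrow> bool" where
  "is_F k p' m lam x \<longleftrightarrow>
     x \<in> {0..1 - 2 powr (lam - 1)} \<and>
     alpha x (1 - 2 powr (lam - 1)) = ln (real (num_candidates k p' lam)) / real m"

definition F :: "nat \<Rightarrow> nat \<Rightarrow> nat \<Rightarrow> real \<Rightarrow> real" where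
  "F k p' m lam = (THE x. is_F k p' m lam x)"

text \<open>The positivity conditions exclude the conventions \<open>ln 0 = 0\<close> and \<open>x / 0 = 0\<close>, under which the
  defining equation could have a meaningless solution.\<close>

definition F_defined :: "nat \<Rightarrow> nat \<Rightarrow> nat \<Rightarrow> real \<Rightarrow> bool" where
  "F_defined k p' m lam \<longleftrightarrow>
     0 \<le> lam \<and> lam < 1 \<and> 0 < m \<and> 0 < num_candidates k p' lam \<and> (\<exists>!x. is_F k p' m lam x)"

text \<open>The last condition says that \<open>n p\<close> is the real number \<open>log 2 (p choose k p) / R\<close> rounded to an
  adjacent integer, in either direction.\<close>

definition fixed_rate_regime :: "real \<Rightarrow> (nat \<Rightarrow> nat) \<Rightarrow> (nat \<Rightarrow> nat) \<Rightarrow> bool" where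
  "fixed_rate_regime R k n \<longleftrightarrow>
     filterlim k at_top sequentially \<and>
     (\<lambda>p. real (k p)) \<in> o(\<lambda>p. real p) \<and>
     (\<forall>\<^sub>F p in sequentially. \<bar>real (n p) - log 2 (real (p choose k p)) / R\<bar> < 1)"

definition aas :: "(nat \<Rightarrow> nat) \<Rightarrow> (nat \<Rightarrow> nat) \<Rightarrow> (nat \<Rightarrow> outcome \<Rightarrow> bool) \<Rightarrow> bool" where
  "aas k n A \<longleftrightarrow>
     (\<lambda>p. measure_pmf.prob (bernoulli_model p (k p) (n p)) {\<omega>. A p \<omega>}) \<longlonglongrightarrow> 1"

definition levels :: "real \<Rightarrow> nat \<Rightarrow> nat set" where
  "levels \<epsilon> k = {l. int l \<le> \<lfloor>(1 - \<epsilon>) * real k\<rfloor>}"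

definition F_decrement_bound :: "real \<Rightarrow> real \<Rightarrow> nat \<Rightarrow> nat \<Rightarrow> nat \<Rightarrow> bool" where
  "F_decrement_bound \<epsilon> D k p' m \<longleftrightarrow>
     (\<forall>l \<in> levels \<epsilon> k.
        F_defined k p' m (real l / real k) \<and>
        F_defined k p' m (real (l + 1) / real k) \<and>
        F k p' m (real (l + 1) / real k) - F k p' m (real l / real k)
          \<le> - D * (ln ((real p' - real k) / real k) / real m))"

definition F_strictly_decreasing :: "real \<Rightarrow> nat \<Rightarrow> nat \<Rightarrow> nat \<Rightarrow> bool" where
  "F_strictly_decreasing \<epsilon> k p' m \<longleftrightarrow>
     (\<forall>l \<in> levels \<epsilon> k. F_defined k p' m (real l / real k)) \<and>
     strict_antimono_on (levels \<epsilon> k) (\<lambda>l. F k p' m (real l / real k))"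

end

theory Submission
  imports Defs "HOL-Real_Asymp.Real_Asymp"
begin

text \<open>Put \<open>r = 2R - 1\<close>, \<open>L = ln ((p' - k) / k)\<close>, \<open>h = ln 2 / k\<close>, \<open>A = h n\<^sub>p\<^sub>o\<^sub>s\<close> and
  \<open>M = (1 - \<lambda>) ln 2\<close>. Since \<open>1 - \<nu> / k = 2 powr (- 1 / k)\<close> exactly, Chebyshev's inequality for the
  number of negative tests, and then for \<open>p' - k\<close> given the defective columns, shows that
  a.a.s. \<open>L / A\<close> is close to \<open>r\<close>, while \<open>L\<close> and \<open>A\<close> tend to infinity. The right-hand side \<open>g\<close> of the
  equation defining \<open>F\<close> is then about \<open>r M\<close>, and passing from \<open>\<ell>\<close> to \<open>\<ell> + 1\<close> lowers it by at most
  about \<open>r h\<close>. With \<open>y = 1 - exp (- M)\<close> and \<open>x = F(\<lambda>)\<close>, the same step lowers \<open>y\<close>, and thereby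
  \<open>alpha x y\<close> by at least about \<open>h (1 - x / y)\<close>. As \<open>alpha 0 y = M\<close> and \<open>alpha y y = 0\<close>, strict
  convexity in the first argument gives \<open>1 - x / y > r\<close> with a uniform margin, so the decrease
  of \<open>y\<close> wins and the root has to move to the left by a constant multiple of
  \<open>r h\<close>, that is, of \<open>L / n\<^sub>p\<^sub>o\<^sub>s\<close>.\<close>


subsection \<open>The relative entropy\<close>

lemma alpha_expand:
  assumes "0 < x" "x < 1" "0 < y" "y < 1"
  shows "alpha x y = x * ln x - x * ln y + (1 - x) * ln (1 - x) - (1 - x) * ln (1 - y)"
  using assms by (simp add: alpha_def ln_div algebra_simps)

lemma has_real_derivative_alpha:
  assumes "0 < x" "x < 1" "0 < y" "y < 1"
  shows "((\<lambda>x. alpha x y) has_real_derivative ln (x * (1 - y) / (y * (1 - x)))) (at x)"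
proof (rule has_field_derivative_transform_within_open)
  show "((\<lambda>x. x * ln x - x * ln y + (1 - x) * ln (1 - x) - (1 - x) * ln (1 - y))
      has_real_derivative ln (x * (1 - y) / (y * (1 - x)))) (at x)"
    using assms by (auto intro!: derivative_eq_intros simp: ln_div ln_mult)
  show "open {0<..<1::real}" "x \<in> {0<..<1}"
    using assms by auto
  fix x :: real assume "x \<in> {0<..<1}"
  then show "x * ln x - x * ln y + (1 - x) * ln (1 - x) - (1 - x) * ln (1 - y) = alpha x y"
    using alpha_expand[of x y] assms by simp
qed

text \<open>In HOL \<open>ln 0 = 0\<close>, so \<open>x * ln x\<close> takes its right-hand limit at
  \<open>0\<close>. This carries the continuity of \<open>alpha\<close> up to that end
  point.\<close>

lemma continuous_on_mult_ln_nonneg: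
  fixes S :: "real set"
  assumes "S \<subseteq> {0..}"
  shows "continuous_on S (\<lambda>x. x * ln x)"
proof -
  have "((\<lambda>x::real. x * ln x) \<longlongrightarrow> 0) (at_right 0)"
    by real_asymp
  then have "continuous (at x within {0..}) (\<lambda>x. x * ln x)" if "x \<ge> 0" for x :: real
    using that by (cases "x = 0")
      (auto simp: continuous_within at_within_Ici_at_right intro!: tendsto_eq_intros)
  then show ?thesis
    using assms continuous_on_subset continuous_on_eq_continuous_within by (metis atLeast_iff)
qed

lemma continuous_on_alpha:
  assumes "0 < y" "y < 1"
  shows "continuous_on {0..y} (\<lambda>x. alpha x y)"
proof -
  \<comment> \<open>Factoring out \<open>y\<close> brings the first summand into the form
    \<open>t * ln t\<close> with \<open>t = x / y\<close>.\<close>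
  have "continuous_on {0..y} (\<lambda>x. y * ((x / y) * ln (x / y)) + (1 - x) * ln ((1 - x) / (1 - y)))"
    using assms
    by (intro continuous_intros continuous_on_compose2[OF continuous_on_mult_ln_nonneg[of "{0..}"]]) auto
  then show ?thesis
    using assms by (simp add: alpha_def)
qed

text \<open>The slope is the logarithm of the odds ratio of \<open>x\<close> and \<open>y\<close>,
  which is negative to the left of \<open>y\<close>. Only the open interval is differentiated, since
  the slope is unbounded near \<open>0\<close>.\<close>

lemma alpha_strict_antimono:
  assumes "0 < y" "y < 1" "0 \<le> a" "a < b" "b \<le> y"
  shows "alpha b y < alpha a y"
proof (rule DERIV_neg_imp_decreasing_open[OF \<open>a < b\<close>])
  fix x assume x: "a < x" "x < b"
  have "x * (1 - y) < y * (1 - x)"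
    using x assms by (simp add: algebra_simps)
  then have "ln (x * (1 - y) / (y * (1 - x))) < 0"
    using x assms by (subst ln_less_zero_iff) (auto simp: field_simps)
  then show "\<exists>z. ((\<lambda>x. alpha x y) has_real_derivative z) (at x) \<and> z < 0"
    using has_real_derivative_alpha[of x y] x assms by auto
next
  show "continuous_on {a..b} (\<lambda>x. alpha x y)"
    using assms by (intro continuous_on_subset[OF continuous_on_alpha[of y]]) auto
qed

text \<open>\<open>alpha\<close> falls strictly to \<open>alpha y y = 0\<close>, so a single point
  \<open>c\<close> where it still reaches \<open>g\<close> yields a root by the intermediate value
  theorem, and monotonicity makes it unique on all of \<open>{0..y}\<close>.\<close>

lemma alpha_ex1:
  assumes "0 < y" "y < 1" "0 \<le> c" "c \<le> y" "0 \<le> g" "g \<le> alpha c y"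
  shows "\<exists>!x. x \<in> {0..y} \<and> alpha x y = g"
proof -
  have "\<exists>x\<ge>c. x \<le> y \<and> alpha x y = g"
    using assms
    by (intro IVT2' continuous_on_subset[OF continuous_on_alpha[of y]]) (auto simp: alpha_def)
  then obtain x where "c \<le> x" "x \<le> y" "alpha x y = g"
    by blast
  then have "x \<in> {0..y}" "alpha x y = g"
    using assms by auto
  moreover have "x' = x" if "x' \<in> {0..y}" "alpha x' y = g" for x'
    using alpha_strict_antimono[of y x x'] alpha_strict_antimono[of y x' x] that calculation assms
    by (cases x x' rule: linorder_cases) auto
  ultimately show ?thesis by blast
qed

text \<open>Below, \<open>M\<close> stands for \<open>(1 - \<lambda>) ln 2\<close>, so that \<open>1 - exp (- M)\<close> is \<open>1 - 2 powr (\<lambda> - 1)\<close>.\<close>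

lemma alpha_lower_near_zero:
  assumes "0 < c" "c \<le> 1 / 2" "0 < M" "M \<le> 1"
  shows "M - 4 * sqrt c \<le> alpha c (1 - exp (- M))"
proof -
  have sq: "c \<le> sqrt c"
    using assms by (intro real_le_rsqrt) (simp add: power2_eq_square mult_left_le)
  \<comment> \<open>The square root makes the bound on \<open>c * ln c\<close> vanish with
    \<open>c\<close>; the same inequality at \<open>1 / c\<close> would only give
    \<open>c - 1\<close>.\<close>
  have "ln (1 / sqrt c) \<le> 1 / sqrt c - 1"
    using assms by (intro ln_le_minus_one) auto
  then have "ln c \<ge> - 2 / sqrt c + 2"
    using assms by (simp add: ln_div ln_sqrt)
  then have "c * ln c \<ge> c * (- 2 / sqrt c + 2)"
    using assms by (intro mult_left_mono) auto
  also have "c * (- 2 / sqrt c + 2) = - 2 * (c / sqrt c) + 2 * c"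
    by (simp add: algebra_simps)
  also have "c / sqrt c = sqrt c"
    using assms by (simp add: real_div_sqrt)
  finally have 1: "c * ln c \<ge> - 2 * sqrt c + 2 * c" .
  have "ln (1 / (1 - c)) \<le> 1 / (1 - c) - 1"
    using assms by (intro ln_le_minus_one) auto
  then have "(1 - c) * - ln (1 - c) \<le> (1 - c) * (1 / (1 - c) - 1)"
    using assms by (intro mult_left_mono) (auto simp: ln_div)
  then have 2: "(1 - c) * ln (1 - c) \<ge> - c"
    using assms by (simp add: algebra_simps)
  have 3: "c * ln (1 - exp (- M)) \<le> 0"
    using assms by (intro mult_nonneg_nonpos) auto
  have 4: "c * M \<le> c"
    using assms by (simp add: mult_left_le)
  have "alpha c (1 - exp (- M)) =
      c * ln c - c * ln (1 - exp (- M)) + (1 - c) * ln (1 - c) + (M - c * M)"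
    using assms by (subst alpha_expand) (auto simp: algebra_simps)
  then show ?thesis
    using 1 2 3 4 sq assms by linarith
qed

text \<open>By convexity the graph lies below the chord from \<open>(0, M)\<close> to
  \<open>(y, 0)\<close>, whose height at \<open>s * y\<close> is \<open>(1 - s) * M\<close>. The
  negative term \<open>y * s * ln s\<close> is the gain from strict convexity.\<close>

lemma alpha_upper_scaled:
  assumes "0 < s" "s < 1" "0 < M"
  defines "y \<equiv> 1 - exp (- M)"
  shows "alpha (s * y) y \<le> (1 - s) * M + y * s * ln s"
proof -
  define z where "z = 1 - s * y"
  have y: "0 < y" "y < 1"
    using assms by (auto simp: y_def)
  then have sy: "0 < s * y" "s * y < y"
    using assms by (auto simp: mult_less_cancel_right2)
  have z: "0 < z" "z < 1"
    using y sy by (auto simp: z_def)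
  have "ln (z / exp (- M)) \<le> z / exp (- M) - 1"
    using z by (intro ln_le_minus_one) auto
  then have "s * exp (- M) * (ln z + M) \<le> s * exp (- M) * (z / exp (- M) - 1)"
    using z assms by (intro mult_left_mono) (auto simp: ln_div)
  also have "\<dots> = s * z - s * exp (- M)"
    by (simp add: algebra_simps)
  finally have 1: "s * exp (- M) * (ln z + M) \<le> s * z - s * exp (- M)" .
  have "ln z \<le> z - 1"
    using z by (intro ln_le_minus_one) auto
  then have 2: "(1 - s) * ln z \<le> (1 - s) * (z - 1)"
    using assms by (intro mult_left_mono) auto
  \<comment> \<open>\<open>z\<close> is the mean of \<open>1\<close> and \<open>exp (- M)\<close>
    with weights \<open>1 - s\<close> and \<open>s\<close>. The two tangent bounds add up to zero,
    which leaves Jensen's inequality for \<open>t * ln t\<close>.\<close>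
  have "z * ln z = (1 - s) * ln z + s * exp (- M) * (ln z + M) - s * exp (- M) * M"
    by (simp add: z_def y_def algebra_simps)
  also have "\<dots> \<le> (1 - s) * (z - 1) + (s * z - s * exp (- M)) - s * exp (- M) * M"
    using 1 2 by linarith
  also have "\<dots> = - s * exp (- M) * M"
    by (simp add: z_def y_def algebra_simps)
  finally have 3: "z * ln z \<le> - s * exp (- M) * M" .
  have "alpha (s * y) y = s * y * ln s + z * ln z + z * M"
  proof -
    have "s * y < 1"
      using y sy by linarith
    moreover have "ln (s * y) = ln s + ln y" "ln (1 - y) = - M"
      using y assms by (auto simp: ln_mult y_def)
    ultimately show ?thesis
      using y sy by (simp add: alpha_expand z_def algebra_simps)
  qed
  also have "\<dots> \<le> s * y * ln s + (- s * exp (- M) * M) + z * M"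
    using 3 by linarith
  also have "\<dots> = (1 - s) * M + y * s * ln s"
    by (simp add: z_def y_def algebra_simps)
  finally show ?thesis .
qed

text \<open>\<open>ln (1 - y)\<close> changes by exactly \<open>h\<close>, which contributes
  \<open>(1 - x) * h\<close>. The change of \<open>ln y\<close> takes away at most
  \<open>x * h * (1 - y) / y\<close>, and the difference is \<open>h * (1 - x / y)\<close>.\<close>

lemma alpha_diff_snd:
  assumes "0 < h" "h < M" "0 < x" "x < 1"
  defines "y \<equiv> 1 - exp (- (M - h))"
  shows "h * (1 - x / y) \<le> alpha x (1 - exp (- M)) - alpha x y"
proof -
  define y' where "y' = 1 - exp (- M)"
  have y: "0 < y" "y < 1" "0 < y'" "y' < 1"
    using assms by (auto simp: y_def y'_def)
  have "y' - y = (1 - y) * (1 - exp (- h))"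
    by (simp add: y_def y'_def algebra_simps flip: exp_add)
  also have "\<dots> \<le> (1 - y) * h"
    using y exp_ge_add_one_self[of "-h"] by (intro mult_left_mono) auto
  finally have d: "y' - y \<le> (1 - y) * h" .
  have "ln (y' / y) \<le> y' / y - 1"
    using y by (intro ln_le_minus_one) auto
  also have "\<dots> = (y' - y) / y"
    using y by (simp add: field_simps)
  also have "\<dots> \<le> (1 - y) * h / y"
    using y d by (intro divide_right_mono) auto
  finally have "x * (ln y' - ln y) \<le> x * ((1 - y) * h / y)"
    using y assms by (intro mult_left_mono) (auto simp: ln_div)
  moreover have "alpha x y' - alpha x y = (1 - x) * h - x * (ln y' - ln y)"
    using y assms(1-4) by (simp add: alpha_expand, simp add: y_def y'_def algebra_simps)
  moreover have "(1 - x) * h - x * ((1 - y) * h / y) = h * (1 - x / y)"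
    using y by (simp add: field_simps)
  ultimately show ?thesis
    unfolding y'_def by linarith
qed

text \<open>Mean value theorem: between \<open>a\<close> and \<open>y \<le> 1 / 2\<close> the slope
  is at most \<open>ln (2 / a)\<close> in size. This limits the rise of \<open>alpha\<close> when
  its argument moves slightly to the left.\<close>

lemma alpha_diff_fst:
  assumes "0 < a" "a \<le> b" "b \<le> y" "0 < y" "y \<le> 1 / 2"
  shows "alpha a y - alpha b y \<le> (b - a) * ln (2 / a)"
proof (cases "a = b")
  case False
  then have "a < b" using assms by simp
  then obtain z where z: "a < z" "z < b"
    "alpha b y - alpha a y = (b - a) * ln (z * (1 - y) / (y * (1 - z)))"
    using MVT2[of a b "\<lambda>x. alpha x y" "\<lambda>z. ln (z * (1 - y) / (y * (1 - z)))"]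
      has_real_derivative_alpha assms by force
  have "y * (1 - z) * a \<le> z * (1 - y) * 2"
  proof -
    have "y * (1 - z) * a \<le> 1 * z"
      using z assms by (intro mult_mono mult_le_one) auto
    also have "\<dots> \<le> z * ((1 - y) * 2)"
      using z assms by (simp add: mult_left_mono)
    finally show ?thesis by (simp add: algebra_simps)
  qed
  then have "y * (1 - z) / (z * (1 - y)) \<le> 2 / a"
    using z assms by (simp add: field_simps)
  then have "ln (y * (1 - z) / (z * (1 - y))) \<le> ln (2 / a)"
    using z assms by (subst ln_le_cancel_iff) auto
  moreover have "ln (z * (1 - y) / (y * (1 - z))) = - ln (y * (1 - z) / (z * (1 - y)))"
    using z assms by (simp add: ln_div)
  ultimately have "(b - a) * - ln (z * (1 - y) / (y * (1 - z))) \<le> (b - a) * ln (2 / a)"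
    using \<open>a < b\<close> by (intro mult_left_mono) auto
  then show ?thesis
    using z by simp
qed (use assms in auto)

subsection \<open>Displacement of the root\<close>

text \<open>Suppose \<open>x' > x - \<delta>\<close> with \<open>\<delta> = D * \<rho> * h\<close>.
  Then \<open>alpha x' y' < alpha (x - \<delta>) y'\<close>, which exceeds \<open>alpha x y'\<close>
  by at most \<open>h * \<sigma> / 4\<close>, while \<open>alpha x y'\<close> is at most
  \<open>g - h * (r + \<sigma> / 2)\<close>. Together this is at most
  \<open>g - h * (\<rho> + B)\<close>, hence at most \<open>g'\<close>, contradicting
  \<open>alpha x' y' = g'\<close>.\<close>

lemma alpha_root_decrement:
  fixes r \<epsilon> :: real
  assumes "0 < r" "r < 1" "0 < \<epsilon>" "\<epsilon> \<le> 1"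
  obtains D \<eta> where "0 < D" "0 < \<eta>"
    "\<And>h \<rho> B M g g'. 0 < h \<Longrightarrow> h \<le> \<eta> \<Longrightarrow> \<bar>\<rho> - r\<bar> \<le> \<eta> \<Longrightarrow> 0 \<le> B \<Longrightarrow> B \<le> \<eta> \<Longrightarrow>
       \<epsilon> / 4 \<le> M - h \<Longrightarrow> M \<le> ln 2 \<Longrightarrow>
       M * \<rho> \<le> g \<Longrightarrow> g \<le> M * \<rho> + B \<Longrightarrow>
       (M - h) * \<rho> \<le> g' \<Longrightarrow> g' \<le> (M - h) * \<rho> + B \<Longrightarrow> g - h * (\<rho> + B) \<le> g' \<Longrightarrow>
       (\<exists>!x. x \<in> {0..1 - exp (- M)} \<and> alpha x (1 - exp (- M)) = g) \<and>
       (\<exists>!x. x \<in> {0..1 - exp (- (M - h))} \<and> alpha x (1 - exp (- (M - h))) = g') \<and>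
       (\<forall>x x'. x \<in> {0..1 - exp (- M)} \<longrightarrow> alpha x (1 - exp (- M)) = g \<longrightarrow>
          x' \<in> {0..1 - exp (- (M - h))} \<longrightarrow> alpha x' (1 - exp (- (M - h))) = g' \<longrightarrow>
          x' \<le> x - D * \<rho> * h)"
proof -
  \<comment> \<open>The roots lie in \<open>{c..s * y}\<close>: the lower end bounds the slope of \<open>alpha\<close>, and the upper end
    gives the margin \<open>\<sigma>\<close> in \<open>1 - x / y > r\<close>.\<close>
  define c where "c = ((1 - r) * \<epsilon> / 64)\<^sup>2"
  define \<sigma> where "\<sigma> = \<epsilon> * r * (1 - r) / 64"
  \<comment> \<open>\<open>ln (4 / c)\<close> bounds the slope of \<open>alpha\<close> from
    \<open>c / 2\<close> on, so moving by \<open>D * \<rho> * h\<close> costs at most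
    \<open>h * \<sigma> / 4\<close>.\<close>
  define D where "D = \<sigma> / (4 * ln (4 / c))"
  define \<eta> where "\<eta> = min (\<epsilon> * \<sigma> / 16) (c / 2)"
  define s where "s = 1 - r - \<sigma>"
  have re: "0 < (1 - r) * \<epsilon>" "(1 - r) * \<epsilon> \<le> \<epsilon>" "(1 - r) * \<epsilon> < 1" "0 < r * (1 - r)" "r * (1 - r) < r"
      "r * (1 - r) < 1 - r"
    using assms by (auto simp: mult_less_cancel_left2 mult_le_cancel_right2 mult_less_cancel_right2
      intro!: mult_strict_mono[of _ 1 _ 1, simplified] less_le_trans[of "(1-r)*\<epsilon>" \<epsilon> 1])
  have c: "0 < c" "c \<le> \<epsilon> / 64" "sqrt c = (1 - r) * \<epsilon> / 64"
  proof -
    show "0 < c" "sqrt c = (1 - r) * \<epsilon> / 64"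
      using re by (auto simp: c_def)
    have "c \<le> (1 - r) * \<epsilon> / 64 * 1"
      unfolding c_def power2_eq_square using re by (intro mult_left_mono) auto
    then show "c \<le> \<epsilon> / 64"
      using re by simp
  qed
  have \<sigma>: "0 < \<sigma>" "\<sigma> \<le> r / 64" "\<sigma> \<le> (1 - r) / 64" "\<sigma> \<le> (1 - r) * \<epsilon> / 64"
  proof -
    have 1: "\<epsilon> * (r * (1 - r)) \<le> 1 * (r * (1 - r))" "r * ((1 - r) * \<epsilon>) \<le> 1 * ((1 - r) * \<epsilon>)"
      using assms re by (intro mult_right_mono; simp)+
    have 2: "\<sigma> = \<epsilon> * (r * (1 - r)) / 64" "\<sigma> = r * ((1 - r) * \<epsilon>) / 64"
      by (auto simp: \<sigma>_def)
    have "\<epsilon> * (r * (1 - r)) \<le> r" "\<epsilon> * (r * (1 - r)) \<le> 1 - r"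
      using order_trans[OF 1(1)] re(5,6) by (simp_all only: mult_1 less_imp_le)
    then show "\<sigma> \<le> r / 64" "\<sigma> \<le> (1 - r) / 64"
      unfolding 2(1) by (simp_all only: divide_right_mono zero_le_numeral)
    show "\<sigma> \<le> (1 - r) * \<epsilon> / 64"
      unfolding 2(2) using 1(2) by simp
    show "0 < \<sigma>"
      using assms by (simp add: \<sigma>_def)
  qed
  have "\<epsilon> * \<sigma> \<le> 1 * \<sigma>"
    using assms \<sigma> by (intro mult_right_mono) auto
  moreover have "0 < \<eta>" "\<eta> \<le> \<epsilon> * \<sigma> / 16" "\<eta> \<le> c / 2"
    using c \<sigma> assms by (auto simp: \<eta>_def)
  ultimately have \<eta>: "0 < \<eta>" "\<eta> \<le> \<sigma> / 16" "\<eta> \<le> \<epsilon> * \<sigma> / 16" "\<eta> \<le> c / 2"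
    by linarith+
  have c4: "1 < ln (4 / c)"
  proof -
    have "exp 1 < 4 / c"
      using c assms exp_le by (intro le_less_trans[OF exp_le]) (auto simp: field_simps)
    then have "ln (exp 1) < ln (4 / c)"
      using c by (subst ln_less_cancel_iff) auto
    then show ?thesis by simp
  qed
  have D: "0 < D" "D \<le> 1" "D * ln (4 / c) = \<sigma> / 4"
    using c4 \<sigma> assms by (auto simp: D_def field_simps)
  have s: "0 < s" "s < 1" "(1 - r) / 2 \<le> s" "r \<le> 1 - s"
    using \<sigma> assms by (auto simp: s_def)
  have ln2: "ln 2 \<le> (1::real)"
    using ln_add_one_self_le_self[of 1] by simp
  have ysmall: "M / 2 \<le> 1 - exp (- M)" if "0 < M" "M \<le> ln 2" for M :: real
  proof -
    have "1 + M \<le> exp M"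
      by simp
    then have "exp (- M) \<le> 1 / (1 + M)"
      using that by (simp add: exp_minus field_simps)
    then have "M / (1 + M) \<le> 1 - exp (- M)"
      using that by (simp add: field_simps)
    moreover have "M / 2 \<le> M / (1 + M)"
      using that ln2 by (intro divide_left_mono) auto
    ultimately show ?thesis by linarith
  qed
  have yhalf: "1 - exp (- M) \<le> 1 / 2" if "M \<le> ln 2" for M :: real
    using that exp_le_cancel_iff[of "- ln 2" "- M"] by (simp add: exp_minus)
  show thesis
  proof (rule that[OF D(1) \<eta>(1)])
    fix h \<rho> B M g g' :: real
    assume h: "0 < h" "h \<le> \<eta>" and \<rho>: "\<bar>\<rho> - r\<bar> \<le> \<eta>" and B: "0 \<le> B" "B \<le> \<eta>"
      and M: "\<epsilon> / 4 \<le> M - h" "M \<le> ln 2"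
      and g: "M * \<rho> \<le> g" "g \<le> M * \<rho> + B"
      and g': "(M - h) * \<rho> \<le> g'" "g' \<le> (M - h) * \<rho> + B"
      and step: "g - h * (\<rho> + B) \<le> g'"
    define y where "y = 1 - exp (- M)"
    define y' where "y' = 1 - exp (- (M - h))"
    have M0: "0 < M" "0 < M - h" "M - h \<le> ln 2" "\<epsilon> / 4 \<le> M"
      using M h assms by auto
    have \<rho>1: "0 < \<rho>" "\<rho> < 1" "r - \<sigma> / 16 \<le> \<rho>" "1 - \<rho> \<ge> (1 - r) / 2"
      using \<rho> \<eta> \<sigma> assms by auto
    have y: "\<epsilon> / 8 \<le> y" "\<epsilon> / 8 \<le> y'" "y \<le> 1 / 2" "y' \<le> 1 / 2" "y' < y"
      unfolding y_def y'_def using ysmall[of M] ysmall[of "M - h"] yhalf[of M] yhalf[of "M - h"] M M0 h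
      by auto
    have y01: "0 < y" "y < 1" "0 < y'" "y' < 1"
      using y assms by auto
    \<comment> \<open>At \<open>c\<close> the loss \<open>4 * sqrt c\<close> is
      \<open>e / 16\<close> and \<open>B\<close> is at most \<open>e / 1024\<close>, together less
      than the gap \<open>N * (1 - \<rho>) \<ge> e / 8\<close>. This puts both roots to the right of
      \<open>c\<close>.\<close>
    have low: "G < alpha c (1 - exp (- N))" if "\<epsilon> / 4 \<le> N" "N \<le> ln 2" "G \<le> N * \<rho> + B" for N G
    proof -
      define e where "e = (1 - r) * \<epsilon>"
      have "N - 4 * sqrt c \<le> alpha c (1 - exp (- N))"
        using that ln2 c assms by (intro alpha_lower_near_zero) auto
      then have 1: "N - e / 16 \<le> alpha c (1 - exp (- N))"
        unfolding c(3) e_def by (simp add: mult.commute)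
      have "(\<epsilon> / 4) * ((1 - r) / 2) \<le> N * (1 - \<rho>)"
        using that \<rho>1 assms by (intro mult_mono) auto
      then have 2: "e / 8 \<le> N - N * \<rho>"
        by (simp add: e_def algebra_simps)
      have "B \<le> e / 1024" "0 < e"
        using B \<eta> \<sigma> re(1) unfolding e_def by linarith+
      then show ?thesis
        using 1 2 that(3) by linarith
    qed
    have nonneg: "0 \<le> g" "0 \<le> g'"
      using g g' M0 \<rho>1 by (auto intro: order_trans[rotated])
    have ex: "\<exists>!x. x \<in> {0..y} \<and> alpha x y = g"
      using low[of M g] M M0 g c y01 y nonneg assms unfolding y_def
      by (intro alpha_ex1[of _ c]) auto
    have ex': "\<exists>!x. x \<in> {0..y'} \<and> alpha x y' = g'"
      using low[of "M - h" g'] M M0 g' c y01 y nonneg assms unfolding y'_def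
      by (intro alpha_ex1[of _ c]) auto
    have "x' \<le> x - D * \<rho> * h"
      if x: "0 \<le> x" "x \<le> y" "alpha x y = g" and x': "0 \<le> x'" "x' \<le> y'" "alpha x' y' = g'" for x x'
    proof (rule ccontr)
      assume contr: "\<not> x' \<le> x - D * \<rho> * h"
      have cx: "c \<le> x"
        using low[of M g] M M0 g x alpha_strict_antimono[of y x c] y01 y c assms
        unfolding y_def by (cases "x < c") auto
      \<comment> \<open>Beyond \<open>s * y\<close> the chord bound gives less than
        \<open>(r + \<sigma>) * M + y * s * ln s\<close>. As \<open>ln s \<le> - r\<close>, the last
        term is at most \<open>- 4 * \<sigma>\<close>, which outweighs the excess over
        \<open>\<rho> * M\<close>, so \<open>alpha\<close> would be below \<open>g\<close>.\<close>
      have xs: "x \<le> s * y"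
      proof (rule ccontr)
        assume "\<not> x \<le> s * y"
        then have "alpha x y < alpha (s * y) y"
          using x y01 s by (intro alpha_strict_antimono) auto
        also have "\<dots> \<le> (1 - s) * M + y * s * ln s"
          unfolding y_def using s M0 by (intro alpha_upper_scaled) auto
        finally have 1: "alpha x y < r * M + \<sigma> * M + y * s * ln s"
          by (simp add: s_def algebra_simps)
        have "ln s \<le> s - 1"
          using s by (intro ln_le_minus_one) auto
        then have "ln s \<le> - r"
          using s by linarith
        then have 2: "y * s * ln s \<le> y * s * (- r)"
          using y01 s by (intro mult_left_mono) auto
        have "(\<epsilon> / 8) * ((1 - r) / 2) \<le> y * s"
          using y s assms by (intro mult_mono) auto
        then have "(\<epsilon> / 8) * ((1 - r) / 2) * r \<le> y * s * r"
          using assms by (intro mult_right_mono) auto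
        then have 3: "4 * \<sigma> \<le> y * s * r"
          by (simp add: \<sigma>_def algebra_simps)
        have "(r - \<sigma> / 16) * M \<le> \<rho> * M"
          using \<rho>1 M0 by (intro mult_right_mono) auto
        then have 4: "r * M - \<sigma> * M / 16 \<le> M * \<rho>"
          by (simp add: algebra_simps)
        have "\<sigma> * M \<le> \<sigma> * 1"
          using \<sigma> M M0 ln2 by (intro mult_left_mono) linarith+
        then have "alpha x y < M * \<rho>"
          using 1 2 3 4 \<sigma>(1) by linarith
        then show False
          using x g by simp
      qed
      have "y - y' = (1 - y') * (1 - exp (- h))"
        by (simp add: y_def y'_def algebra_simps flip: exp_add)
      also have "\<dots> \<le> 1 * h"
        using y01 h exp_ge_add_one_self[of "-h"] by (intro mult_mono) auto
      finally have yy: "y - y' \<le> h" by simp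
      \<comment> \<open>Replacing \<open>y\<close> by \<open>y'\<close> in the ratio costs at most
        \<open>\<sigma> / 2\<close>, as \<open>h \<le> \<epsilon> * \<sigma> / 16\<close> and
        \<open>y' \<ge> \<epsilon> / 8\<close>; half of the margin survives.\<close>
      have "x / y' \<le> s * y / y'"
        using xs y01 by (intro divide_right_mono) auto
      also have "\<dots> \<le> s * (y' + h) / y'"
        using yy s y01 by (intro divide_right_mono mult_left_mono) auto
      also have "\<dots> = s + s * h / y'"
        using y01 by (simp add: field_simps)
      also have "s * h / y' \<le> 1 * h / (\<epsilon> / 8)"
        using y s h assms by (intro frac_le mult_right_mono) auto
      also have "1 * h / (\<epsilon> / 8) \<le> (\<epsilon> * \<sigma> / 16) / (\<epsilon> / 8)"
        using h \<eta> assms by (intro divide_right_mono) auto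
      also have "\<dots> = \<sigma> / 2"
        using assms by simp
      finally have xy': "r + \<sigma> / 2 \<le> 1 - x / y'"
        by (simp add: s_def)
      then have "x / y' < 1"
        using assms \<sigma> by linarith
      then have xy: "x < y'"
        using y01 by simp
      define \<delta> where "\<delta> = D * \<rho> * h"
      have "\<delta> \<le> 1 * 1 * (c / 2)"
        unfolding \<delta>_def using D \<rho>1 h \<eta> by (intro mult_mono) auto
      then have \<delta>: "0 < \<delta>" "\<delta> \<le> c / 2"
        using D \<rho>1 h by (auto simp: \<delta>_def)
      have "alpha (x - \<delta>) y' - alpha x y' \<le> (x - (x - \<delta>)) * ln (2 / (x - \<delta>))"
        using \<delta> cx c xy y01 y by (intro alpha_diff_fst) auto
      also have "\<dots> \<le> \<delta> * ln (4 / c)"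
      proof -
        have "2 / (x - \<delta>) \<le> 2 / (c / 2)"
          using \<delta> cx c by (intro divide_left_mono) auto
        then show ?thesis
          using \<delta> cx c by (auto intro!: mult_left_mono)
      qed
      also have "\<dots> = \<rho> * h * (\<sigma> / 4)"
        using D(3) by (simp add: \<delta>_def)
      also have "\<dots> \<le> h * (\<sigma> / 4)"
        using \<rho>1 h \<sigma> by (simp add: mult_le_cancel_right2)
      finally have 1: "alpha (x - \<delta>) y' - alpha x y' \<le> h * (\<sigma> / 4)" .
      have "h * (r + \<sigma> / 2) \<le> h * (1 - x / y')"
        using xy' h by (intro mult_left_mono) auto
      also have "\<dots> \<le> alpha x y - alpha x y'"
        unfolding y_def y'_def using cx c x y01 h M0
        by (intro alpha_diff_snd) (auto simp flip: y_def)
      finally have 2: "h * (r + \<sigma> / 2) \<le> g - alpha x y'"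
        using x by simp
      have "h * (\<rho> + B) \<le> h * (r + \<sigma> / 4)"
        using \<rho> B \<eta> \<sigma> h by (intro mult_left_mono) auto
      then have "alpha (x - \<delta>) y' \<le> g'"
        using 1 2 step by (simp add: algebra_simps)
      moreover have "alpha x' y' < alpha (x - \<delta>) y'"
        using contr x' \<delta> cx c y01 by (intro alpha_strict_antimono) (auto simp: \<delta>_def)
      ultimately show False
        using x' by simp
    qed
    then show "(\<exists>!x. x \<in> {0..1 - exp (- M)} \<and> alpha x (1 - exp (- M)) = g) \<and>
       (\<exists>!x. x \<in> {0..1 - exp (- (M - h))} \<and> alpha x (1 - exp (- (M - h))) = g') \<and>
       (\<forall>x x'. x \<in> {0..1 - exp (- M)} \<longrightarrow> alpha x (1 - exp (- M)) = g \<longrightarrow>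
          x' \<in> {0..1 - exp (- (M - h))} \<longrightarrow> alpha x' (1 - exp (- (M - h))) = g' \<longrightarrow>
          x' \<le> x - D * \<rho> * h)"
      using ex ex' unfolding y_def y'_def by simp
  qed
qed

subsection \<open>Counting candidates\<close>

text \<open>The left side divided by \<open>fact n\<close> is one term of the exponential series at
  \<open>n\<close>.\<close>

lemma power_le_fact_mult_exp: "real n ^ n \<le> fact n * exp (real n)"
proof -
  have "real n ^ n /\<^sub>R fact n \<le> (\<Sum>i. real n ^ i /\<^sub>R fact i)"
    using sum_le_suminf[OF summable_exp_generic[of "real n"], of "{n}"] by simp
  then show ?thesis
    by (simp add: exp_def field_simps)
qed

lemma ln_binomial_ge:
  assumes "0 < j" "j \<le> N"
  shows "real j * ln (real N / real j) \<le> ln (real (N choose j))"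
proof -
  have "ln ((real N / real j) ^ j) \<le> ln (real (N choose j))"
    using assms binomial_ge_n_over_k_pow_k[of j N, where ?'a = real] by (subst ln_le_cancel_iff) auto
  then show ?thesis
    using assms by (simp add: ln_realpow)
qed

text \<open>\<open>N choose j\<close> is at most \<open>N ^ j / fact j\<close>, and
  \<open>power_le_fact_mult_exp\<close> bounds \<open>fact j\<close> from below.\<close>

lemma ln_binomial_le:
  assumes "0 < j" "j \<le> N"
  shows "ln (real (N choose j)) \<le> real j * (ln (real N / real j) + 1)"
proof -
  have "real (N choose j) * real j ^ j \<le> real (N choose j) * (fact j * exp (real j))"
    by (intro mult_left_mono power_le_fact_mult_exp) auto
  also have "\<dots> = real ((N choose j) * fact j) * exp (real j)"
    by simp
  also have "\<dots> \<le> real (N ^ j) * exp (real j)"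
    using binomial_fact_pow[of N j] by (intro mult_right_mono) (auto simp only: of_nat_le_iff, auto)
  finally have "real (N choose j) \<le> (real N / real j) ^ j * exp (real j)"
    using assms by (simp add: field_simps)
  then have "ln (real (N choose j)) \<le> ln ((real N / real j) ^ j * exp (real j))"
    using assms by (subst ln_le_cancel_iff) auto
  also have "\<dots> = real j * (ln (real N / real j) + 1)"
    using assms by (simp add: ln_mult ln_realpow algebra_simps)
  finally show ?thesis .
qed

lemma num_candidates_at_level:
  assumes "0 < k" "l \<le> k"
  shows "num_candidates k p' (real l / real k) = (k choose l) * ((p' - k) choose (k - l))"
proof -
  have "(1 - real l / real k) * real k = real (k - l)"
    using assms by (simp add: field_simps of_nat_diff)
  then show ?thesis
    using assms by (simp only: num_candidates_def floor_of_nat nat_int) simp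
qed

lemma num_candidates_pos:
  assumes "0 < k" "l \<le> k" "2 * k \<le> p'"
  shows "0 < num_candidates k p' (real l / real k)"
  using assms by (simp add: num_candidates_at_level zero_less_binomial_iff)

text \<open>The second binomial coefficient carries the main term. Writing \<open>N / k\<close> for
  \<open>N / j\<close> costs at most a constant per item since
  \<open>j \<ge> \<epsilon> * k / 2\<close>, and the first coefficient lies between \<open>1\<close>
  and \<open>2 ^ k\<close>.\<close>

lemma ln_num_candidates_bounds:
  fixes \<epsilon> :: real
  assumes "0 < \<epsilon>" "\<epsilon> \<le> 1" "\<epsilon> * real k / 2 \<le> real k - real l" "l < k" "2 * k \<le> p'"
  defines "L \<equiv> ln ((real p' - real k) / real k)"
  shows "(real k - real l) * L \<le> ln (real (num_candidates k p' (real l / real k)))"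
    and "ln (real (num_candidates k p' (real l / real k))) \<le> (real k - real l) * L + real k * (4 / \<epsilon>)"
proof -
  define N where "N = p' - k"
  define j where "j = k - l"
  have N: "real N = real p' - real k" "k \<le> N" and j: "0 < j" "j \<le> N" "j \<le> k" "real j = real k - real l"
    using assms by (auto simp: N_def j_def of_nat_diff)
  have k: "0 < k" using assms by simp
  have eq: "ln (real (num_candidates k p' (real l / real k))) = ln (real (k choose l)) + ln (real (N choose j))"
    using assms N j by (simp add: num_candidates_at_level ln_mult flip: N_def j_def)
  have *: "ln (real N / real j) = L + ln (real k / real j)"
    unfolding L_def N(1)[symmetric] using N j k by (simp add: ln_div)
  have "0 \<le> ln (real k / real j)"
    using j by simp
  then have "real j * L \<le> real j * ln (real N / real j)"
    using * by (intro mult_left_mono) auto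
  also have "\<dots> \<le> ln (real (N choose j))"
    using j by (intro ln_binomial_ge) auto
  also have "\<dots> \<le> ln (real (num_candidates k p' (real l / real k)))"
    using assms by (simp add: eq Suc_le_eq zero_less_binomial)
  finally show "(real k - real l) * L \<le> ln (real (num_candidates k p' (real l / real k)))"
    by (simp add: j)
  have "real (k choose l) \<le> 2 ^ k"
    using binomial_le_pow2[of k l] by (metis of_nat_le_iff of_nat_numeral of_nat_power)
  then have "ln (real (k choose l)) \<le> ln (2 ^ k)"
    using assms by (subst ln_le_cancel_iff) (auto simp: zero_less_binomial)
  also have "\<dots> = real k * ln 2"
    by (simp add: ln_realpow)
  also have "\<dots> \<le> real k * 1"
    using ln_add_one_self_le_self[of 1] by (intro mult_left_mono) auto
  finally have 1: "ln (real (k choose l)) \<le> real k" by simp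
  have "ln (real k / real j) \<le> real k / real j - 1"
    using j k by (intro ln_le_minus_one) auto
  also have "\<dots> \<le> 2 / \<epsilon> - 1"
    using assms j k by (simp add: field_simps)
  finally have "real j * (ln (real k / real j) + 1) \<le> real k * (2 / \<epsilon>)"
    using j assms by (intro mult_mono) auto
  moreover have "ln (real (N choose j)) \<le> real j * (ln (real N / real j) + 1)"
    using j by (intro ln_binomial_le) auto
  ultimately have "ln (real (N choose j)) \<le> real j * L + real k * (2 / \<epsilon>)"
    unfolding * by (simp add: algebra_simps)
  moreover obtain e where e: "real k * (2 / \<epsilon>) = e"
    by blast
  moreover have "real k * 2 \<le> e"
    unfolding e[symmetric] using assms by (intro mult_left_mono) (auto simp: field_simps)
  moreover have "real k * (4 / \<epsilon>) = 2 * e"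
    by (simp flip: e)
  ultimately show "ln (real (num_candidates k p' (real l / real k))) \<le> (real k - real l) * L + real k * (4 / \<epsilon>)"
    using 1 of_nat_0_le_iff[of k, where ?'a = real] unfolding eq j(4) e by linarith
qed

text \<open>Ratio of consecutive coefficients, cleared of denominators. For \<open>n \<le> i\<close>
  both sides vanish, the right one by truncated subtraction.\<close>

lemma Suc_mult_choose_Suc: "Suc i * (n choose Suc i) = (n - i) * (n choose i)"
  using times_binomial_minus1_eq[of "Suc i" n] binomial_absorb_comp[of n i] by simp

text \<open>The two bounds in \<open>ln_num_candidates_bounds\<close> differ by order
  \<open>k\<close>, too much for a single step. With \<open>N = p' - k\<close> and
  \<open>i = k - l - 1\<close>, the two counts have the exact ratio
  \<open>(k - l)^2 / ((l + 1) * (N - i))\<close>, whose logarithm is at least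
  \<open>- L - 2 * ln (2 / \<epsilon>)\<close>.\<close>

lemma ln_num_candidates_Suc_ge:
  fixes \<epsilon> :: real
  assumes "0 < \<epsilon>" "\<epsilon> \<le> 1" "\<epsilon> * real k / 2 \<le> real k - real l" "l < k" "2 * k \<le> p'"
  defines "L \<equiv> ln ((real p' - real k) / real k)"
  shows "ln (real (num_candidates k p' (real l / real k))) - (L + 4 / \<epsilon>)
      \<le> ln (real (num_candidates k p' (real (Suc l) / real k)))"
proof -
  define N where "N = p' - k"
  define i where "i = k - Suc l"
  have N: "real N = real p' - real k" "k \<le> N" and i: "k - l = Suc i" "i < N" "real i + 1 = real k - real l"
    using assms by (auto simp: N_def i_def of_nat_diff)
  have k: "0 < k" using assms by simp
  have pos: "0 < k choose l" "0 < k choose Suc l" "0 < N choose Suc i" "0 < N choose i"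
    using assms(4) i by (auto simp: zero_less_binomial)
  have "real (Suc l) * real (k choose Suc l) = real (Suc i) * real (k choose l)"
    using Suc_mult_choose_Suc[of l k] i by (metis of_nat_mult)
  then have "ln (real (Suc l) * real (k choose Suc l)) = ln (real (Suc i) * real (k choose l))"
    by simp
  then have a: "ln (real (Suc l)) + ln (real (k choose Suc l)) = ln (real (Suc i)) + ln (real (k choose l))"
    using pos by (subst (asm) (1 2) ln_mult) auto
  have "real (Suc i) * real (N choose Suc i) = real (N - i) * real (N choose i)"
    using Suc_mult_choose_Suc[of i N] by (metis of_nat_mult)
  then have "ln (real (Suc i) * real (N choose Suc i)) = ln (real (N - i) * real (N choose i))"
    by simp
  then have b: "ln (real (Suc i)) + ln (real (N choose Suc i)) = ln (real (N - i)) + ln (real (N choose i))"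
    using pos i by (subst (asm) (1 2) ln_mult) auto
  have "ln (real (num_candidates k p' (real l / real k))) = ln (real (k choose l)) + ln (real (N choose Suc i))"
    using pos k assms(4) i by (simp add: num_candidates_at_level ln_mult flip: N_def)
  moreover have "ln (real (num_candidates k p' (real (Suc l) / real k)))
      = ln (real (k choose Suc l)) + ln (real (N choose i))"
    using pos k assms(4) i by (subst num_candidates_at_level) (simp_all add: ln_mult flip: N_def i_def)
  moreover have "ln (2 / \<epsilon>) \<le> 2 / \<epsilon> - 1"
    using assms by (intro ln_le_minus_one) auto
  moreover have "ln (real (Suc l)) \<le> ln (real k)" "ln (real (N - i)) \<le> ln (real N)"
    using assms(4) i k by auto
  moreover have "ln (\<epsilon> * real k / 2) \<le> ln (real (Suc i))"
    using assms(1,3) i(3) k by (subst ln_le_cancel_iff) auto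
  moreover have "ln (\<epsilon> * real k / 2) = ln (real k) - ln (2 / \<epsilon>)"
    using assms(1) k by (simp add: ln_mult ln_div)
  moreover have "L = ln (real N) - ln (real k)"
    using k N unfolding L_def N(1)[symmetric] by (simp add: ln_div)
  ultimately show ?thesis
    using a b by linarith
qed

subsection \<open>The decrement of F\<close>

text \<open>Instance of \<open>alpha_root_decrement\<close> with \<open>h = ln 2 / k\<close>,
  \<open>M = (k - l) * h\<close>, \<open>\<rho> = L / A\<close> and
  \<open>B = 4 / (\<epsilon> * A)\<close>; the counting bounds are divided by \<open>m\<close>, and
  \<open>A = m * h\<close>. The constants depend only on \<open>r\<close> and
  \<open>\<epsilon>\<close>.\<close>

lemma F_decrement_bound_if:
  fixes r \<epsilon> :: real
  assumes "0 < r" "r < 1" "0 < \<epsilon>" "\<epsilon> \<le> 1"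
  obtains D \<delta> K where "0 < D" "0 < \<delta>" "0 < K"
    "\<And>k p' m A. K \<le> real k \<Longrightarrow> 2 * k \<le> p' \<Longrightarrow> A = real m * (ln 2 / real k) \<Longrightarrow> K \<le> A \<Longrightarrow>
       \<bar>ln ((real p' - real k) / real k) / A - r\<bar> \<le> \<delta> \<Longrightarrow> F_decrement_bound \<epsilon> D k p' m"
proof -
  obtain D \<eta> where D: "0 < D" "0 < \<eta>" and root:
    "\<And>h \<rho> B M g g'. 0 < h \<Longrightarrow> h \<le> \<eta> \<Longrightarrow> \<bar>\<rho> - r\<bar> \<le> \<eta> \<Longrightarrow> 0 \<le> B \<Longrightarrow> B \<le> \<eta> \<Longrightarrow>
       \<epsilon> / 4 \<le> M - h \<Longrightarrow> M \<le> ln 2 \<Longrightarrow>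
       M * \<rho> \<le> g \<Longrightarrow> g \<le> M * \<rho> + B \<Longrightarrow>
       (M - h) * \<rho> \<le> g' \<Longrightarrow> g' \<le> (M - h) * \<rho> + B \<Longrightarrow> g - h * (\<rho> + B) \<le> g' \<Longrightarrow>
       (\<exists>!x. x \<in> {0..1 - exp (- M)} \<and> alpha x (1 - exp (- M)) = g) \<and>
       (\<exists>!x. x \<in> {0..1 - exp (- (M - h))} \<and> alpha x (1 - exp (- (M - h))) = g') \<and>
       (\<forall>x x'. x \<in> {0..1 - exp (- M)} \<longrightarrow> alpha x (1 - exp (- M)) = g \<longrightarrow>
          x' \<in> {0..1 - exp (- (M - h))} \<longrightarrow> alpha x' (1 - exp (- (M - h))) = g' \<longrightarrow>
          x' \<le> x - D * \<rho> * h)"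
    using alpha_root_decrement[OF assms] by blast
  \<comment> \<open>The three terms ensure \<open>h \<le> \<eta>\<close>,
    \<open>2 \<le> \<epsilon> * k\<close> and \<open>B \<le> \<eta>\<close>, in this order.\<close>
  define K where "K = max (1 / \<eta>) (max (2 / \<epsilon>) (4 / (\<epsilon> * \<eta>)))"
  have ln2: "1 / 2 \<le> ln (2::real)" "ln 2 \<le> (1::real)"
    using ln_add_one_self_le_self[of 1] ln_one_minus_pos_upper_bound[of "1/2"] by (auto simp: ln_div)
  show thesis
  proof (rule that[OF D])
    show "0 < K"
      using D by (simp add: K_def less_max_iff_disj)
    fix k p' m :: nat and A :: real
    assume k: "K \<le> real k" and p': "2 * k \<le> p'" and A: "A = real m * (ln 2 / real k)" "K \<le> A"
      and \<rho>: "\<bar>ln ((real p' - real k) / real k) / A - r\<bar> \<le> \<eta>"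
    define L where "L = ln ((real p' - real k) / real k)"
    define h where "h = ln 2 / real k"
    define B where "B = 4 / \<epsilon> / A"
    define y where "y l = 1 - exp (- ((real k - real l) * h))" for l
    define g where "g l = ln (real (num_candidates k p' (real l / real k))) / real m" for l
    have k0: "0 < k" "1 / \<eta> \<le> real k" "2 / \<epsilon> \<le> real k"
      using k \<open>0 < K\<close> by (auto simp: K_def)
    have A0: "0 < A" "4 / (\<epsilon> * \<eta>) \<le> A"
      using A \<open>0 < K\<close> by (auto simp: K_def)
    have m0: "0 < m"
      using A A0 by (cases m) auto
    have h: "0 < h" "A = real m * h" "real k * h = ln 2"
      using k0 A by (auto simp: h_def)
    have "h \<le> 1 / real k"
      using ln2 unfolding h_def by (intro divide_right_mono) auto
    also have "\<dots> \<le> \<eta>"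
      using k0 D by (simp add: field_simps)
    finally have h\<eta>: "h \<le> \<eta>" .
    have B: "0 \<le> B" "B \<le> \<eta>"
      using A0 D assms by (auto simp: B_def field_simps)
    have is_F_iff: "is_F k p' m (real l / real k) x \<longleftrightarrow> x \<in> {0..y l} \<and> alpha x (y l) = g l" for l x
    proof -
      have "2 powr (real l / real k - 1) = exp (- ((real k - real l) * h))"
        using k0 by (simp add: powr_def h_def field_simps)
      then show ?thesis
        by (simp add: is_F_def y_def g_def)
    qed
    have main: "(\<exists>!x. is_F k p' m (real l / real k) x) \<and> (\<exists>!x. is_F k p' m (real (Suc l) / real k) x) \<and>
        (\<forall>x x'. is_F k p' m (real l / real k) x \<longrightarrow> is_F k p' m (real (Suc l) / real k) x' \<longrightarrow>
           x' \<le> x - D * (L / A) * h) \<and> Suc l < k"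
      if "l \<in> levels \<epsilon> k" for l
    proof -
      have "real l \<le> (1 - \<epsilon>) * real k"
        using that by (auto simp: levels_def le_floor_iff)
      \<comment> \<open>This absorbs the step from \<open>l\<close> to \<open>l + 1\<close>: the
        latter may lie outside \<open>levels\<close>, but its distance from \<open>k\<close> is
        still at least \<open>\<epsilon> * k / 2\<close>.\<close>
      moreover have "2 \<le> \<epsilon> * real k"
        using k0 assms by (simp add: field_simps)
      ultimately have l: "\<epsilon> * real k / 2 \<le> real k - real l" "\<epsilon> * real k / 2 \<le> real k - real (Suc l)"
        "Suc l < k"
        by (auto simp: algebra_simps)
      have shift: "(real k - real l) * h - h = (real k - real (Suc l)) * h"
        by (simp add: algebra_simps)
      have bounds: "(real k - real j) * h * (L / A) \<le> g j \<and> g j \<le> (real k - real j) * h * (L / A) + B"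
        if j: "\<epsilon> * real k / 2 \<le> real k - real j" "j < k" for j
      proof
        have "(real k - real j) * h * (L / A) = (real k - real j) * L / real m"
          using h m0 by (simp add: field_simps)
        also have "\<dots> \<le> g j"
          unfolding g_def L_def using j p' assms
          by (intro divide_right_mono ln_num_candidates_bounds(1)[of \<epsilon>]) auto
        finally show "(real k - real j) * h * (L / A) \<le> g j" .
        have "g j \<le> ((real k - real j) * L + real k * (4 / \<epsilon>)) / real m"
          unfolding g_def L_def using j p' assms
          by (intro divide_right_mono ln_num_candidates_bounds(2)[of \<epsilon>]) auto
        also have "\<dots> = (real k - real j) * h * (L / A) + real k * h * B"
          using h(1,2) m0 assms by (simp add: B_def field_simps)
        also have "real k * h * B \<le> 1 * B"
          using h ln2 B by (intro mult_right_mono) auto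
        finally show "g j \<le> (real k - real j) * h * (L / A) + B" by simp
      qed
      have "g l - h * (L / A + B) = (ln (real (num_candidates k p' (real l / real k))) - (L + 4 / \<epsilon>)) / real m"
        using h m0 assms by (simp add: g_def B_def field_simps)
      also have "\<dots> \<le> g (Suc l)"
        unfolding g_def L_def using l p' assms
        by (intro divide_right_mono ln_num_candidates_Suc_ge) auto
      finally have step: "g l - h * (L / A + B) \<le> g (Suc l)" .
      have "\<epsilon> / 4 \<le> (\<epsilon> / 2) * (real k * h)"
        using ln2 h assms by (simp add: field_simps)
      also have "\<dots> \<le> (real k - real (Suc l)) * h"
        using mult_right_mono[OF l(2), of h] h by (simp add: algebra_simps)
      finally have lo: "\<epsilon> / 4 \<le> (real k - real l) * h - h"
        unfolding shift .
      have up: "(real k - real l) * h \<le> ln 2"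
        using h by (simp add: algebra_simps)
      show ?thesis
        unfolding is_F_iff y_def
        using root[of h "L / A" B "(real k - real l) * h" "g l" "g (Suc l)"] h h\<eta> \<rho> B lo up step l
          bounds[of l] bounds[of "Suc l"]
        unfolding shift L_def[symmetric] by auto
    qed
    show "F_decrement_bound \<epsilon> D k p' m"
      unfolding F_decrement_bound_def
    proof
      fix l assume l: "l \<in> levels \<epsilon> k"
      have F: "is_F k p' m (real l / real k) (F k p' m (real l / real k))"
        "is_F k p' m (real (Suc l) / real k) (F k p' m (real (Suc l) / real k))"
        using main[OF l] unfolding F_def by (auto intro: theI')
      then have "F k p' m (real (Suc l) / real k) \<le> F k p' m (real l / real k) - D * (L / A) * h"
        using main[OF l] by blast
      also have "D * (L / A) * h = D * (L / real m)"
        using h m0 by (simp add: field_simps)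
      finally have "F k p' m (real (l + 1) / real k) - F k p' m (real l / real k) \<le> - D * (L / real m)"
        by simp
      moreover have "0 < num_candidates k p' (real l / real k)"
        "0 < num_candidates k p' (real (Suc l) / real k)"
        using main[OF l] k0 p' by (intro num_candidates_pos; simp)+
      ultimately show "F_defined k p' m (real l / real k) \<and>
          F_defined k p' m (real (l + 1) / real k) \<and>
          F k p' m (real (l + 1) / real k) - F k p' m (real l / real k)
            \<le> - D * (ln ((real p' - real k) / real k) / real m)"
        using main[OF l] m0 unfolding F_defined_def L_def[symmetric] by simp
    qed
  qed
qed

text \<open>\<open>levels\<close> is closed downwards, so single decrements chain from
  \<open>i\<close> to \<open>j\<close>. Their strictness also rests on \<open>0 < m\<close>, which
  \<open>F_defined\<close> supplies.\<close>

lemma F_strictly_decreasing_if: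
  assumes "F_decrement_bound \<epsilon> D k p' m" "0 < D" "0 < ln ((real p' - real k) / real k)"
  shows "F_strictly_decreasing \<epsilon> k p' m"
  unfolding F_strictly_decreasing_def
proof
  show "\<forall>l\<in>levels \<epsilon> k. F_defined k p' m (real l / real k)"
    using assms by (auto simp: F_decrement_bound_def)
  have step: "F k p' m (real (Suc l) / real k) < F k p' m (real l / real k)" if "l \<in> levels \<epsilon> k" for l
  proof -
    have "0 < m"
      using assms(1) that by (auto simp: F_decrement_bound_def F_defined_def)
    then have "- D * (ln ((real p' - real k) / real k) / real m) < 0"
      using assms by simp
    then show ?thesis
      using assms(1) that by (force simp: F_decrement_bound_def)
  qed
  show "strict_antimono_on (levels \<epsilon> k) (\<lambda>l. F k p' m (real l / real k))"
  proof (intro monotone_onI)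
    fix i j assume "i \<in> levels \<epsilon> k" and "j \<in> levels \<epsilon> k" "i < j"
    from \<open>i < j\<close> \<open>j \<in> levels \<epsilon> k\<close>
    show "F k p' m (real j / real k) < F k p' m (real i / real k)"
    proof (induction j)
      case (Suc j)
      then have "j \<in> levels \<epsilon> k"
        by (auto simp: levels_def)
      then show ?case
        using Suc step[of j] by (cases "i = j") (auto intro: less_trans)
    qed simp
  qed
qed

subsection \<open>Concentration of the numbers of negative tests and of potentially defective items\<close>

text \<open>Union bound for a two-stage experiment: first-stage outcomes in \<open>G\<close> are
  given up entirely, the others contribute at most \<open>b\<close>.\<close>

lemma measure_bind_pmf_le:
  assumes "\<And>x. x \<in> set_pmf M \<Longrightarrow> x \<notin> G \<Longrightarrow> measure_pmf.prob (K x) E \<le> b" "0 \<le> b"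
  shows "measure_pmf.prob (bind_pmf M K) E \<le> measure_pmf.prob M G + b"
proof -
  have "emeasure (bind_pmf M K) E = (\<integral>\<^sup>+x. emeasure (K x) E \<partial>M)"
    by simp
  also have "\<dots> \<le> (\<integral>\<^sup>+x. indicator G x + ennreal b \<partial>M)"
  proof (intro nn_integral_mono_AE, simp add: AE_measure_pmf_iff, intro ballI)
    fix x assume x: "x \<in> set_pmf M"
    show "emeasure (K x) E \<le> indicator G x + ennreal b"
    proof (cases "x \<in> G")
      case True
      then show ?thesis
        using measure_pmf.emeasure_le_1[of "K x" E] by (auto intro: add_increasing2)
    next
      case False
      then show ?thesis
        using assms(1)[OF x] by (simp add: measure_pmf.emeasure_eq_measure ennreal_leI)
    qed
  qed
  also have "\<dots> = emeasure M G + ennreal b"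
    by (subst nn_integral_add) auto
  finally have "ennreal (measure_pmf.prob (bind_pmf M K) E) \<le> ennreal (measure_pmf.prob M G + b)"
    using assms(2) by (simp add: measure_pmf.emeasure_eq_measure del: emeasure_bind_pmf)
  then show ?thesis
    using assms(2) by (subst (asm) ennreal_le_iff) auto
qed

text \<open>Serves with \<open>C\<close> the defective entries of a test, which is then negative,
  and with \<open>C\<close> the entries of an item in all negative tests, which then stays
  potentially defective; also with two such sets joined.\<close>

lemma measure_Pi_pmf_bernoulli_all_False:
  assumes "finite A" "C \<subseteq> A" "0 \<le> q" "q \<le> 1"
  shows "measure_pmf.prob (Pi_pmf A False (\<lambda>_. bernoulli_pmf q)) {f. \<forall>x\<in>C. \<not> f x} = (1 - q) ^ card C"
proof -
  have "{f. \<forall>x\<in>C. \<not> f x} = Pi A (\<lambda>x. if x \<in> C then {False} else UNIV)"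
    using assms by (auto simp: Pi_def split: if_splits)
  then have "measure_pmf.prob (Pi_pmf A False (\<lambda>_. bernoulli_pmf q)) {f. \<forall>x\<in>C. \<not> f x}
      = (\<Prod>x\<in>A. measure_pmf.prob (bernoulli_pmf q) (if x \<in> C then {False} else UNIV))"
    using assms by (simp add: measure_Pi_pmf_Pi)
  also have "\<dots> = (\<Prod>x\<in>A. if x \<in> C then 1 - q else 1)"
    using assms by (intro prod.cong) (auto simp: measure_pmf_single)
  also have "\<dots> = (1 - q) ^ card C"
    using assms by (simp add: prod.If_cases Int_absorb1)
  finally show ?thesis .
qed

text \<open>Pairwise independence suffices for the variance \<open>card I * (q - q^2)\<close>.
  Dropping \<open>q^2\<close> bounds it by the mean, which loses little for small
  \<open>q\<close>.\<close>

lemma Chebyshev_card_pmf: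
  fixes M :: "'a pmf" and E :: "'i \<Rightarrow> 'a \<Rightarrow> bool"
  assumes "finite I" "0 < a"
    and single: "\<And>i. i \<in> I \<Longrightarrow> measure_pmf.prob M {x. E i x} = q"
    and pair: "\<And>i j. i \<in> I \<Longrightarrow> j \<in> I \<Longrightarrow> i \<noteq> j \<Longrightarrow> measure_pmf.prob M {x. E i x \<and> E j x} = q\<^sup>2"
  shows "measure_pmf.prob M {x. a \<le> \<bar>real (card {i \<in> I. E i x}) - real (card I) * q\<bar>}
      \<le> real (card I) * q / a\<^sup>2"
proof -
  define f where "f x = (\<Sum>i\<in>I. indicator {x. E i x} x :: real)" for x
  have f: "f x = real (card {i \<in> I. E i x})" for x
    using assms(1) by (simp add: f_def indicator_def sum.If_cases Int_def)
  have sq: "(f x)\<^sup>2 = (\<Sum>i\<in>I. \<Sum>j\<in>I. indicator {x. E i x \<and> E j x} x)" for x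
    by (simp add: f_def power2_eq_square sum_product indicator_def of_bool_conj)
  have ind: "integrable M (indicator A :: 'a \<Rightarrow> real)" for A
    by (intro measure_pmf.integrable_const_bound[where B = 1]) auto
  have int: "integrable M f"
    unfolding f_def by (intro Bochner_Integration.integrable_sum ind)
  have int2: "integrable M (\<lambda>x. (f x)\<^sup>2)"
    unfolding sq by (intro Bochner_Integration.integrable_sum ind)
  have exp: "measure_pmf.expectation M f = real (card I) * q"
    unfolding f_def by (subst Bochner_Integration.integral_sum) (auto simp: single ind)
  have "measure_pmf.expectation M (\<lambda>x. (f x)\<^sup>2) = (\<Sum>i\<in>I. \<Sum>j\<in>I. measure_pmf.prob M {x. E i x \<and> E j x})"
    unfolding sq by (simp add: Bochner_Integration.integral_sum Bochner_Integration.integrable_sum ind)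
  also have "\<dots> = (\<Sum>i\<in>I. \<Sum>j\<in>I. if i = j then q else q\<^sup>2)"
    by (intro sum.cong refl) (auto simp: single pair)
  also have "\<dots> = (\<Sum>i\<in>I. \<Sum>j\<in>I. q\<^sup>2 + (if i = j then q - q\<^sup>2 else 0))"
    by (intro sum.cong refl) auto
  also have "\<dots> = (real (card I) * q)\<^sup>2 + real (card I) * (q - q\<^sup>2)"
    using assms(1) by (simp add: sum.distrib power2_eq_square algebra_simps)
  finally have "measure_pmf.variance M f = real (card I) * (q - q\<^sup>2)"
    using measure_pmf.variance_eq[OF int int2] exp by simp
  also have "\<dots> \<le> real (card I) * q"
    by (intro mult_left_mono) auto
  finally have var: "measure_pmf.variance M f \<le> real (card I) * q" .
  have "measure_pmf.prob M {x. a \<le> \<bar>f x - measure_pmf.expectation M f\<bar>} \<le> measure_pmf.variance M f / a\<^sup>2"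
    using measure_pmf.Chebyshev_inequality[of f M a] int2 assms(2) by simp
  also have "\<dots> \<le> real (card I) * q / a\<^sup>2"
    using var by (intro divide_right_mono) auto
  finally show ?thesis
    by (simp add: exp f)
qed

lemma nu_properties:
  assumes "0 < k"
  shows "0 \<le> nu k / real k" "nu k / real k \<le> 1" "(1 - nu k / real k) ^ j = 2 powr (- real j / real k)"
proof -
  have nu: "0 < nu k \<and> nu k \<le> real k \<and> (1 - nu k / real k) ^ k = 1 / 2"
    unfolding nu_def by (rule theI'[OF nu_ex1[OF assms]])
  then show le: "0 \<le> nu k / real k" "nu k / real k \<le> 1"
    using assms by auto
  \<comment> \<open>Passing to \<open>powr\<close> calls for a positive base; base \<open>0\<close>
    is excluded because \<open>0 ^ k\<close> is not \<open>1 / 2\<close>.\<close>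
  have "nu k / real k \<noteq> 1"
  proof
    assume "nu k / real k = 1"
    then have "(1 - nu k / real k) ^ k = 0"
      using assms by (simp add: power_0_left)
    then show False
      using nu by simp
  qed
  then have pos: "0 < 1 - nu k / real k"
    using le by linarith
  have "(1 - nu k / real k) powr real k = 2 powr (- 1)"
    using nu pos by (simp add: powr_realpow powr_minus_divide)
  then have "((1 - nu k / real k) powr real k) powr (real j / real k) = (2 powr (- 1)) powr (real j / real k)"
    by (simp only:)
  then show "(1 - nu k / real k) ^ j = 2 powr (- real j / real k)"
    using pos assms unfolding powr_powr by (simp add: powr_realpow)
qed

text \<open>Given the defective columns, and hence the negative tests, the nondefective items are
  potentially defective independently of each other, with probability
  \<open>(1 - \<nu> / k)\<close> to the number of negative tests.\<close>

lemma bernoulli_model_concentration: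
  fixes \<delta> :: real
  assumes "0 < k" "k < p" "0 < n" "0 < \<delta>"
  defines "\<mu> \<equiv> \<lambda>\<omega>. (real p - real k) * 2 powr (- (real n - real (n_pos n \<omega>)) / real k)"
  shows "measure_pmf.prob (bernoulli_model p k n)
      {\<omega>. \<delta> * real n \<le> \<bar>real (n_pos n \<omega>) - real n / 2\<bar> \<or>
           \<mu> \<omega> / 2 \<le> \<bar>real (p_prime p n \<omega>) - real k - \<mu> \<omega>\<bar>}
    \<le> 1 / (2 * \<delta>\<^sup>2 * real n) + 4 / ((real p - real k) * 2 powr (- ((1 / 2 + \<delta>) * real n) / real k))"
    (is "measure_pmf.prob _ ?bad \<le> ?b1 + ?b2")
proof -
  define q where "q = nu k / real k"
  note q = nu_properties[OF assms(1), folded q_def]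
  let ?Pi = "\<lambda>A. Pi_pmf A False (\<lambda>_. bernoulli_pmf q)"
  have b2: "0 \<le> ?b2"
    using assms by simp
  have fixed_S: "measure_pmf.prob (map_pmf (Pair S) (?Pi ({..<n} \<times> {..<p}))) ?bad \<le> ?b1 + ?b2"
    if S: "S \<subseteq> {..<p}" "card S = k" for S
  proof -
    define U where "U = {..<p} - S"
    \<comment> \<open>\<open>A\<close> collects the defective columns, which alone decide the
      negative tests, and \<open>B\<close> the other columns. The design is glued from these two
      independent parts.\<close>
    define A where "A = {..<n} \<times> S"
    define B where "B = {..<n} \<times> U"
    define neg where "neg f = {t \<in> {..<n}. \<forall>x\<in>{t} \<times> S. \<not> f x}" for f :: "nat \<times> nat \<Rightarrow> bool"
    define glue where "glue f g x = (if x \<in> A then f x else g x)" for f g :: "nat \<times> nat \<Rightarrow> bool" and x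
    have fin: "finite S" "finite A" "finite B" "finite U"
      using S finite_subset by (auto simp: A_def B_def U_def)
    have cardU: "real (card U) = real p - real k"
      using S fin assms by (simp add: U_def card_Diff_subset of_nat_diff)
    have "{..<n} \<times> {..<p} = A \<union> B" "A \<inter> B = {}"
      using S by (auto simp: A_def B_def U_def)
    then have split: "?Pi ({..<n} \<times> {..<p}) = bind_pmf (?Pi A) (\<lambda>f. map_pmf (glue f) (?Pi B))"
      using fin by (simp add: Pi_pmf_union pair_pmf_def map_bind_pmf glue_def[abs_def]
          bind_return_pmf map_pmf_def bind_assoc_pmf)
    have positive_glue: "positive (S, glue f g) t \<longleftrightarrow> t \<notin> neg f" if "t < n" for f g t
      using that by (auto simp: positive_def glue_def neg_def A_def)
    have n_pos_glue: "real (n_pos n (S, glue f g)) = real n - real (card (neg f))" for f g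
    proof -
      have "{t \<in> {..<n}. positive (S, glue f g) t} = {..<n} - neg f"
        using positive_glue by auto
      moreover have "neg f \<subseteq> {..<n}"
        by (auto simp: neg_def)
      ultimately show ?thesis
        using card_mono[of "{..<n}" "neg f"]
        by (simp add: n_pos_def card_Diff_subset finite_subset[of "neg f" "{..<n}"] of_nat_diff)
    qed
    have p_prime_glue: "real (p_prime p n (S, glue f g)) - real k
        = real (card {i \<in> U. \<forall>x\<in>neg f \<times> {i}. \<not> g x})" for f g
    proof -
      have "potentially_defective p n (S, glue f g) = S \<union> {i \<in> U. \<forall>x\<in>neg f \<times> {i}. \<not> g x}"
      proof (intro equalityI subsetI)
        fix i assume "i \<in> potentially_defective p n (S, glue f g)"
        then show "i \<in> S \<union> {i \<in> U. \<forall>x\<in>neg f \<times> {i}. \<not> g x}"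
          using positive_glue
          by (fastforce simp: potentially_defective_def U_def glue_def A_def neg_def)
      next
        fix i assume i: "i \<in> S \<union> {i \<in> U. \<forall>x\<in>neg f \<times> {i}. \<not> g x}"
        show "i \<in> potentially_defective p n (S, glue f g)"
        proof (cases "i \<in> S")
          case True
          then show ?thesis
            using S by (auto simp: potentially_defective_def positive_def)
        next
          case False
          then show ?thesis
            using i positive_glue by (auto simp: potentially_defective_def U_def glue_def A_def)
        qed
      qed
      then show ?thesis
        using S fin by (simp add: p_prime_def) (subst card_Un_disjoint; auto simp: U_def)
    qed
    define G where "G = {f. \<delta> * real n \<le> \<bar>real (card (neg f)) - real n * (1 / 2)\<bar>}"
    have "measure_pmf.prob (?Pi A) G \<le> real (card {..<n}) * (1 / 2) / (\<delta> * real n)\<^sup>2"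
    proof -
      have "measure_pmf.prob (?Pi A) {f. \<forall>x\<in>{t} \<times> S. \<not> f x} = 1 / 2" if "t \<in> {..<n}" for t
        using that q S fin assms(1)
        by (subst measure_Pi_pmf_bernoulli_all_False)
          (auto simp: A_def card_cartesian_product powr_minus_divide)
      moreover
      have "measure_pmf.prob (?Pi A) {f. (\<forall>x\<in>{t} \<times> S. \<not> f x) \<and> (\<forall>x\<in>{u} \<times> S. \<not> f x)} = (1 / 2)\<^sup>2"
        if "t \<in> {..<n}" "u \<in> {..<n}" "t \<noteq> u" for t u
      proof -
        have "{f. (\<forall>x\<in>{t} \<times> S. \<not> f x) \<and> (\<forall>x\<in>{u} \<times> S. \<not> f x)} = {f. \<forall>x\<in>{t, u} \<times> S. \<not> f x}"
          by auto
        moreover have "card ({t, u} \<times> S) = k * 2"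
          using that S by (simp add: card_cartesian_product)
        ultimately show ?thesis
          using that q(1,2) q(3)[of k] fin assms(1)
          by (simp only:, subst measure_Pi_pmf_bernoulli_all_False)
            (auto simp: A_def power_mult powr_minus_divide)
      qed
      ultimately show ?thesis
        unfolding G_def neg_def
        using Chebyshev_card_pmf[of "{..<n}" "\<delta> * real n" "?Pi A" "\<lambda>t f. \<forall>x\<in>{t} \<times> S. \<not> f x" "1 / 2"] assms
        by simp
    qed
    also have "\<dots> = ?b1"
      using assms by (simp add: power2_eq_square field_simps)
    finally have G: "measure_pmf.prob (?Pi A) G \<le> ?b1" .
    \<comment> \<open>Outside \<open>G\<close> at most \<open>(1 / 2 + \<delta>) * n\<close> tests
      are negative, which bounds the conditional mean \<open>\<mu>f\<close> from below. Chebyshev's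
      inequality at distance \<open>\<mu>f / 2\<close> gives \<open>4 / \<mu>f\<close>.\<close>
    have cond: "measure_pmf.prob (map_pmf (glue f) (?Pi B)) (Pair S -` ?bad) \<le> ?b2" if f: "f \<notin> G" for f
    proof -
      define w where "w = (1 - q) ^ card (neg f)"
      define \<mu>f where "\<mu>f = real (card U) * w"
      have "w = 2 powr (- real (card (neg f)) / real k)"
        by (simp add: w_def q)
      moreover have "real (card (neg f)) \<le> (1 / 2 + \<delta>) * real n"
        using f by (auto simp: G_def algebra_simps)
      ultimately have w: "0 < w" "2 powr (- ((1 / 2 + \<delta>) * real n) / real k) \<le> w"
        "\<And>g. \<mu> (S, glue f g) = \<mu>f"
        using assms by (auto simp: \<mu>_def n_pos_glue \<mu>f_def cardU intro!: divide_right_mono)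
      have \<mu>f: "0 < \<mu>f"
        using assms(2) w by (simp add: \<mu>f_def cardU)
      have "measure_pmf.prob (map_pmf (glue f) (?Pi B)) (Pair S -` ?bad)
         = measure_pmf.prob (?Pi B) {g. \<mu>f / 2 \<le> \<bar>real (card {i \<in> U. \<forall>x\<in>neg f \<times> {i}. \<not> g x}) - real (card U) * w\<bar>}"
      proof -
        \<comment> \<open>The first alternative of the bad event depends on \<open>f\<close> alone
          and fails outside \<open>G\<close>, so only the second one remains.\<close>
        have "\<not> \<delta> * real n \<le> \<bar>real n - real (card (neg f)) - real n / 2\<bar>"
          using f by (simp add: G_def)
        then show ?thesis
          by (simp add: measure_map_pmf vimage_def w n_pos_glue p_prime_glue \<mu>f_def)
      qed
      also have "\<dots> \<le> real (card U) * w / (\<mu>f / 2)\<^sup>2"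
      proof (intro Chebyshev_card_pmf)
        have neg: "neg f \<subseteq> {..<n}"
          by (auto simp: neg_def)
        fix i assume i: "i \<in> U"
        then show "measure_pmf.prob (?Pi B) {g. \<forall>x\<in>neg f \<times> {i}. \<not> g x} = w"
          using q fin neg by (subst measure_Pi_pmf_bernoulli_all_False)
            (auto simp: B_def card_cartesian_product w_def)
        fix j assume j: "j \<in> U" "i \<noteq> j"
        have "{g. (\<forall>x\<in>neg f \<times> {i}. \<not> g x) \<and> (\<forall>x\<in>neg f \<times> {j}. \<not> g x)} = {g. \<forall>x\<in>neg f \<times> {i, j}. \<not> g x}"
          by auto
        moreover have "card (neg f \<times> {i, j}) = card (neg f) * 2"
          using j by (simp add: card_cartesian_product)
        ultimately
        show "measure_pmf.prob (?Pi B) {g. (\<forall>x\<in>neg f \<times> {i}. \<not> g x) \<and> (\<forall>x\<in>neg f \<times> {j}. \<not> g x)} = w\<^sup>2"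
          using i j q(1,2) fin neg
          by (simp only:, subst measure_Pi_pmf_bernoulli_all_False) (auto simp: B_def w_def power_mult)
      qed (use fin \<mu>f in auto)
      also have "\<dots> = 4 / \<mu>f"
        using \<mu>f by (simp add: \<mu>f_def[symmetric] power2_eq_square)
      also have "\<dots> \<le> ?b2"
        unfolding \<mu>f_def cardU using assms w by (intro divide_left_mono mult_left_mono) auto
      finally show ?thesis .
    qed
    have "measure_pmf.prob (map_pmf (Pair S) (?Pi ({..<n} \<times> {..<p}))) ?bad
        = measure_pmf.prob (bind_pmf (?Pi A) (\<lambda>f. map_pmf (glue f) (?Pi B))) (Pair S -` ?bad)"
      by (simp only: split measure_map_pmf)
    also have "\<dots> \<le> measure_pmf.prob (?Pi A) G + ?b2"
      using cond b2 by (intro measure_bind_pmf_le) auto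
    also have "\<dots> \<le> ?b1 + ?b2"
      using G by simp
    finally show ?thesis .
  qed
  have "{S. S \<subseteq> {..<p} \<and> card S = k} \<noteq> {}"
    using assms obtain_subset_with_card_n[of k "{..<p}"] by auto
  then have "set_pmf (pmf_of_set {S. S \<subseteq> {..<p} \<and> card S = k}) = {S. S \<subseteq> {..<p} \<and> card S = k}"
    by (intro set_pmf_of_set) auto
  \<comment> \<open>The bound is the same for every defective set, so the exceptional set of the
    first stage is empty.\<close>
  then have "measure_pmf.prob (bind_pmf (pmf_of_set {S. S \<subseteq> {..<p} \<and> card S = k})
      (\<lambda>S. map_pmf (Pair S) (?Pi ({..<n} \<times> {..<p})))) ?bad \<le> measure_pmf.prob
        (pmf_of_set {S. S \<subseteq> {..<p} \<and> card S = k}) {} + (?b1 + ?b2)"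
    using fixed_S b2 assms by (intro measure_bind_pmf_le) auto
  then show ?thesis
    by (simp add: bernoulli_model_def pair_pmf_def map_pmf_def q_def)
qed

subsection \<open>The fixed-rate regime\<close>

lemma ln_two_le_one: "ln 2 \<le> (1::real)"
  using ln_add_one_self_le_self[of 1] by simp

text \<open>With \<open>T = ln (p / k)\<close>, the logarithm of \<open>p choose k\<close> lies
  between \<open>k * T\<close> and \<open>k * (T + 1)\<close>, and rounding moves
  \<open>n * ln 2\<close> by at most \<open>1\<close>. The error relative to \<open>k * T\<close> is
  therefore at most \<open>3 / T\<close>, and \<open>T\<close> tends to infinity because
  \<open>k = o(p)\<close>.\<close>

lemma fixed_rate_regime_eventually:
  assumes "fixed_rate_regime R k n" "1 / 2 < R" "0 < \<delta>"
  shows "\<forall>\<^sub>F p in sequentially. K \<le> real (k p) \<and> 0 < k p \<and> 2 * k p \<le> p \<and> K \<le> ln (real p / real (k p)) \<and>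
      \<bar>real (n p) * ln 2 / (real (k p) * ln (real p / real (k p))) - 1 / R\<bar> \<le> \<delta>"
proof -
  define C where "C = max K (max 1 (3 / \<delta>))"
  have "filterlim (\<lambda>p. real (k p)) at_top sequentially"
    using assms by (auto simp: fixed_rate_regime_def intro: filterlim_compose[OF filterlim_real_sequentially])
  then have 1: "\<forall>\<^sub>F p in sequentially. C \<le> real (k p)"
    by (simp add: filterlim_at_top)
  have 2: "\<forall>\<^sub>F p in sequentially. norm (real (k p)) \<le> min (1 / 2) (exp (- C)) * norm (real p)"
    using assms by (intro landau_o.smallD) (auto simp: fixed_rate_regime_def)
  have 3: "\<forall>\<^sub>F p in sequentially. \<bar>real (n p) - log 2 (real (p choose k p)) / R\<bar> < 1"
    using assms by (simp add: fixed_rate_regime_def)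
  from 1 2 3 show ?thesis
  proof eventually_elim
    case (elim p)
    define T where "T = ln (real p / real (k p))"
    define X where "X = ln (real (p choose k p))"
    have C: "1 \<le> C" "3 / \<delta> \<le> C" "K \<le> C"
      by (auto simp: C_def)
    have k: "1 \<le> real (k p)" "0 < k p"
      using elim(1) C by linarith+
    have "min (1 / 2) (exp (- C)) * real p \<le> 1 / 2 * real p"
      "min (1 / 2) (exp (- C)) * real p \<le> exp (- C) * real p"
      by (intro mult_right_mono; simp)+
    then have kp: "2 * k p \<le> p" "real (k p) \<le> exp (- C) * real p"
      using elim(2) by simp_all
    have p: "0 < real p"
      using k kp by simp
    have "exp C \<le> real p / real (k p)"
      using kp(2) k by (simp add: exp_minus field_simps)
    then have "ln (exp C) \<le> T"
      unfolding T_def using k p by (subst ln_le_cancel_iff) auto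
    then have T: "C \<le> T" "1 \<le> T"
      using C by auto
    have X: "real (k p) * T \<le> X" "X \<le> real (k p) * (T + 1)"
      unfolding T_def X_def using k kp by (intro ln_binomial_ge ln_binomial_le; simp)+
    have "\<bar>real (n p) * ln 2 - X / R\<bar> = ln 2 * \<bar>real (n p) - log 2 (real (p choose k p)) / R\<bar>"
    proof -
      have "real (n p) * ln 2 - X / R = ln 2 * (real (n p) - log 2 (real (p choose k p)) / R)"
        by (simp add: log_def X_def field_simps)
      then show ?thesis
        by (simp add: abs_mult)
    qed
    also have "\<dots> \<le> 1 * 1"
      using elim(3) ln_two_le_one by (intro mult_mono) auto
    finally have a: "\<bar>real (n p) * ln 2 - X / R\<bar> \<le> 1" by simp
    define d where "d = X / R - real (k p) * T / R"
    have d: "d = (X - real (k p) * T) * (1 / R)"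
      by (simp add: d_def diff_divide_distrib)
    \<comment> \<open>The factor \<open>2\<close> bounds \<open>1 / R\<close>. Together with the
      rounding error \<open>1 \<le> k\<close> this makes \<open>3 * k\<close>.\<close>
    have "d \<le> real (k p) * 2"
      unfolding d using X assms(2) by (intro mult_mono) (auto simp: field_simps)
    moreover have "0 \<le> d"
      unfolding d using X assms(2) by simp
    moreover have "real (n p) * ln 2 - real (k p) * T / R = (real (n p) * ln 2 - X / R) + d"
      by (simp add: d_def)
    ultimately have "\<bar>real (n p) * ln 2 - real (k p) * T / R\<bar> \<le> real (k p) * 3"
      using a k(1) by linarith
    then have "\<bar>real (n p) * ln 2 - real (k p) * T / R\<bar> / (real (k p) * T) \<le> real (k p) * 3 / (real (k p) * T)"
      using k T by (intro divide_right_mono) auto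
    also have "\<dots> = 3 / T"
      using k by simp
    also have "\<dots> \<le> \<delta>"
    proof -
      have "3 / \<delta> \<le> T"
        using T C by linarith
      then show ?thesis
        using T assms(3) by (simp add: field_simps)
    qed
    also have "\<bar>real (n p) * ln 2 - real (k p) * T / R\<bar> / (real (k p) * T)
        = \<bar>(real (n p) * ln 2 - real (k p) * T / R) / (real (k p) * T)\<bar>"
      using k T by (simp add: abs_divide)
    also have "(real (n p) * ln 2 - real (k p) * T / R) / (real (k p) * T)
        = real (n p) * ln 2 / (real (k p) * T) - 1 / R"
      using k T assms(2) by (simp add: field_simps)
    finally show ?case
      using C elim(1) k kp T by (simp add: T_def)
  qed
qed

section \<open>Deterministic estimates behind the good event\<close>

lemma ln_diff_ge_ln_minus_ln_two:
  fixes p k :: real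
  assumes "0 < k" "2 * k \<le> p"
  shows "ln p - ln 2 \<le> ln (p - k)"
proof -
  have "ln (p / 2) \<le> ln (p - k)"
    using assms by (subst ln_le_cancel_iff) auto
  then show ?thesis
    using assms by (simp add: ln_div)
qed

text \<open>Let \<open>v = (n - m) / n\<close> be the fraction of negative tests. Up to a bounded
  error \<open>ln (N / k)\<close> is \<open>(1 - v * u) * T\<close>, while
  \<open>A = (1 - v) * u * T\<close>; at \<open>v = 1 / 2\<close> and \<open>u = 1 / R\<close> the
  quotient is \<open>2 * R - 1\<close>.\<close>

lemma decrement_ratio_close:
  fixes p k n m N T u R \<delta> w :: real
  assumes R: "1 / 2 < R" "R < 1" and \<delta>: "0 < \<delta>" "\<delta> \<le> 1 / 4"
    and k: "0 < k" "2 * k \<le> p" and T: "T = ln (p / k)" "1 / \<delta> \<le> T"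
    and u: "u = n * ln 2 / (k * T)" "\<bar>u - 1 / R\<bar> \<le> \<delta>"
    and m: "\<bar>m - n / 2\<bar> < \<delta> * n"
    and w: "w = (p - k) * 2 powr (- (n - m) / k)" and N: "\<bar>N - w\<bar> < w / 2"
    and A: "A = m * (ln 2 / k)"
  shows "T / 8 \<le> A" "\<bar>ln (N / k) / A - (2 * R - 1)\<bar> \<le> 48 * \<delta>"
proof -
  have T1: "1 \<le> \<delta> * T" "0 < T"
  proof -
    show "1 \<le> \<delta> * T" using T \<delta> by (simp add: field_simps)
    then show "0 < T" using \<delta> by (smt (verit) mult_nonneg_nonpos)
  qed
  have R1: "1 \<le> 1 / R" "1 / R \<le> 2"
    using R by (auto simp: field_simps)
  have u1: "3 / 4 \<le> u" "u \<le> 9 / 4"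
    using u(2) R1 \<delta> by linarith+
  have n: "n * ln 2 = u * k * T"
    using u(1) k T1 by simp
  have n0: "0 < n"
  proof -
    have "0 < n * ln 2"
      using u1 k T1 unfolding n by (intro mult_pos_pos) auto
    then show ?thesis
      by (simp add: zero_less_mult_iff)
  qed
  define v where "v = (n - m) / n"
  have v: "\<bar>v - 1 / 2\<bar> \<le> \<delta>"
  proof -
    have "v - 1 / 2 = (n / 2 - m) / n"
      using n0 by (simp add: v_def field_simps)
    moreover have "\<bar>(n / 2 - m) / n\<bar> = \<bar>m - n / 2\<bar> / n"
      using n0 by (simp add: abs_divide abs_minus_commute)
    moreover have "\<bar>m - n / 2\<bar> / n \<le> \<delta>"
      using m n0 by (simp add: pos_divide_le_eq)
    ultimately show ?thesis by simp
  qed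
  have mv: "m = (1 - v) * n" "n - m = v * n"
    using n0 by (auto simp: v_def field_simps)
  have Av: "A = (1 - v) * u * T"
    using k n by (simp add: A mv field_simps)
  have "(1 / 4) * (3 / 4) * T \<le> A"
    unfolding Av using v \<delta> u1 T1 by (intro mult_right_mono mult_mono) auto
  then show A8: "T / 8 \<le> A"
    using T1 by linarith
  have p: "0 < p" "0 < p - k"
    using k by auto
  have w0: "0 < w"
    using p by (simp add: w)
  have lnw: "ln w = ln (p - k) - v * u * T"
  proof -
    have "ln w = ln (p - k) + (- (n - m) / k) * ln 2"
      unfolding w using p by (simp add: ln_mult ln_powr)
    also have "(- (n - m) / k) * ln 2 = - v * (n * ln 2) / k"
      unfolding mv(2) by simp
    also have "\<dots> = - v * u * T"
      unfolding n using k by simp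
    finally show ?thesis by simp
  qed
  have lnN: "ln w - ln 2 \<le> ln N" "ln N \<le> ln w + ln 2"
  proof -
    have "w / 2 < N" "N < 2 * w"
      using N w0 by linarith+
    then have "ln (w / 2) \<le> ln N" "ln N \<le> ln (2 * w)"
      using w0 by auto
    then show "ln w - ln 2 \<le> ln N" "ln N \<le> ln w + ln 2"
      using w0 by (simp_all add: ln_div ln_mult)
  qed
  have N0: "0 < N"
    using N w0 by linarith
  have lnp: "ln p - ln 2 \<le> ln (p - k)" "ln (p - k) \<le> ln p"
    using ln_diff_ge_ln_minus_ln_two[of k p] k p by auto
  define L where "L = ln (N / k)"
  have "L = ln N - ln k" "T = ln p - ln k"
    using N0 k p by (auto simp: L_def T ln_div)
  then have L: "\<bar>L - (T - v * u * T)\<bar> \<le> 2"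
    using lnp lnN lnw ln_two_le_one by linarith
  \<comment> \<open>Chosen so that \<open>L - (2 * R - 1) * A\<close> is
    \<open>(1 - u * c) * T\<close> up to a bounded error. At \<open>v = 1 / 2\<close> it equals
    \<open>R\<close>, hence \<open>u * c\<close> is close to \<open>1\<close>.\<close>
  define c where "c = (2 * R - 1) + (2 - 2 * R) * v"
  have "c - R = (2 - 2 * R) * (v - 1 / 2)"
    by (simp add: c_def algebra_simps)
  then have "\<bar>c - R\<bar> = \<bar>2 - 2 * R\<bar> * \<bar>v - 1 / 2\<bar>"
    by (simp add: abs_mult)
  also have "\<dots> \<le> 1 * \<delta>"
    using v R by (intro mult_mono) auto
  finally have cR: "\<bar>c - R\<bar> \<le> \<delta>" by simp
  have "\<bar>u * (c - R)\<bar> \<le> 9 / 4 * \<delta>"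
    unfolding abs_mult using u1 cR by (intro mult_mono) auto
  moreover have "\<bar>R * (1 / R - u)\<bar> \<le> 1 * \<delta>"
    unfolding abs_mult using u(2) R by (intro mult_mono) (auto simp: abs_minus_commute)
  moreover have "1 - u * c = R * (1 / R - u) - u * (c - R)"
    using R by (simp add: field_simps)
  ultimately have "\<bar>1 - u * c\<bar> \<le> 4 * \<delta>"
    using \<delta> by linarith
  then have "\<bar>(1 - u * c) * T\<bar> \<le> 4 * \<delta> * T"
    unfolding abs_mult using T1 by (intro mult_mono) auto
  moreover have "(T - v * u * T) - (2 * R - 1) * A = (1 - u * c) * T"
    by (simp add: Av c_def algebra_simps)
  \<comment> \<open>The bounded error \<open>2\<close> is at most \<open>2 * \<delta> * T\<close>
    because \<open>T \<ge> 1 / \<delta>\<close>; afterwards \<open>T \<le> 8 * A\<close> turns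
    \<open>6\<close> into \<open>48\<close>.\<close>
  ultimately have "\<bar>L - (2 * R - 1) * A\<bar> \<le> 6 * (\<delta> * T)"
    using L T1 by linarith
  also have "\<dots> \<le> 48 * \<delta> * A"
    using mult_left_mono[OF A8, of "48 * \<delta>"] \<delta> by simp
  finally have "\<bar>L - (2 * R - 1) * A\<bar> / A \<le> 48 * \<delta>"
    using A8 T1 by (simp add: pos_divide_le_eq)
  moreover have eq: "L / A - (2 * R - 1) = (L - (2 * R - 1) * A) / A"
    using A8 T1 by (simp add: field_simps)
  ultimately show "\<bar>ln (N / k) / A - (2 * R - 1)\<bar> \<le> 48 * \<delta>"
    unfolding L_def[symmetric] eq abs_divide using A8 T1 by simp
qed

text \<open>As \<open>R > 1 / 2\<close>, the product \<open>(1 / 2 + \<delta>) * u\<close> stays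
  below or at \<open>1\<close>. So even with \<open>(1 / 2 + \<delta>) * n\<close> negative tests a
  nondefective item survives with probability at least \<open>exp (- T) = k / p\<close>. Both error
  terms of \<open>bernoulli_model_concentration\<close> thereby become of order
  \<open>1 / k\<close>.\<close>

lemma expected_count_ge:
  fixes p k n T u R \<delta> :: real
  assumes R: "1 / 2 < R" "R < 1" and \<delta>: "0 < \<delta>" "\<delta> \<le> 1 / 4" "\<delta> \<le> (2 * R - 1) / 8"
    and k: "0 < k" "2 * k \<le> p" and T: "T = ln (p / k)" "2 \<le> T"
    and u: "u = n * ln 2 / (k * T)" "\<bar>u - 1 / R\<bar> \<le> \<delta>"
  shows "k \<le> n" "k / 2 \<le> (p - k) * 2 powr (- ((1 / 2 + \<delta>) * n) / k)"
proof -
  have R1: "1 \<le> 1 / R" "1 / R \<le> 2"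
    using R by (auto simp: field_simps)
  have u1: "3 / 4 \<le> u"
    using u(2) R1 \<delta> by linarith
  have n: "n * ln 2 = u * k * T"
    using u(1) k T by simp
  have "3 / 4 * k * 2 \<le> u * k * T"
    using u1 k T(2) by (intro mult_mono mult_nonneg_nonneg) auto
  then have kn: "k \<le> n * ln 2"
    using n k by linarith
  then have "0 < n * ln 2"
    using k by linarith
  then have "0 < n"
    by (simp add: zero_less_mult_iff)
  then have "n * ln 2 \<le> n * 1"
    using ln_two_le_one by (intro mult_left_mono) auto
  then show "k \<le> n"
    using kn by simp
  have "(1 / 2 + \<delta>) * u \<le> (1 / 2 + \<delta>) * (1 / R + \<delta>)"
    using u(2) \<delta> by (intro mult_left_mono) auto
  also have "\<dots> = 1 / (2 * R) + \<delta> * (1 / R + 1 / 2 + \<delta>)"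
    by (simp add: algebra_simps)
  also have "\<delta> * (1 / R + 1 / 2 + \<delta>) \<le> \<delta> * 4"
    using R1 \<delta> by (intro mult_left_mono) auto
  also have "\<dots> \<le> (2 * R - 1) / 2"
    using \<delta> by simp
  also have "\<dots> \<le> (2 * R - 1) / (2 * R)"
    using R by (intro divide_left_mono) auto
  also have "1 / (2 * R) + (2 * R - 1) / (2 * R) = 1"
    using R by (simp add: field_simps)
  finally have "(1 / 2 + \<delta>) * u * T \<le> 1 * T"
    using T by (intro mult_right_mono) auto
  moreover have "(1 / 2 + \<delta>) * n / k * ln 2 = (1 / 2 + \<delta>) * u * T"
  proof -
    have "(1 / 2 + \<delta>) * n / k * ln 2 = (1 / 2 + \<delta>) * (n * ln 2) / k"
      by simp
    then show ?thesis
      unfolding n using k by simp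
  qed
  ultimately have "exp (- T) \<le> 2 powr (- ((1 / 2 + \<delta>) * n) / k)"
    by (simp add: powr_def)
  moreover have "exp (- T) = k / p"
    using k by (simp add: T exp_minus)
  ultimately have "p / 2 * (k / p) \<le> (p - k) * 2 powr (- ((1 / 2 + \<delta>) * n) / k)"
    using k by (intro mult_mono) auto
  then show "k / 2 \<le> (p - k) * 2 powr (- ((1 / 2 + \<delta>) * n) / k)"
    using k by simp
qed

section \<open>Asymptotically almost sure statements and conclusion\<close>

lemma aasI:
  assumes "\<forall>\<^sub>F p in sequentially. measure_pmf.prob (bernoulli_model p (k p) (n p)) (Bad p) \<le> b p"
    and "b \<longlonglongrightarrow> 0"
    and "\<forall>\<^sub>F p in sequentially. \<forall>\<omega>. \<omega> \<notin> Bad p \<longrightarrow> Q p \<omega>"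
  shows "aas k n Q"
  unfolding aas_def
proof (rule tendsto_sandwich)
  show "\<forall>\<^sub>F p in sequentially. 1 - b p \<le> measure_pmf.prob (bernoulli_model p (k p) (n p)) {\<omega>. Q p \<omega>}"
    using assms(1,3)
  proof eventually_elim
    case (elim p)
    have "1 - b p \<le> measure_pmf.prob (bernoulli_model p (k p) (n p)) (- Bad p)"
      using elim(1) measure_pmf.prob_compl[of "Bad p" "bernoulli_model p (k p) (n p)"]
      by (simp add: Compl_eq_Diff_UNIV)
    also have "\<dots> \<le> measure_pmf.prob (bernoulli_model p (k p) (n p)) {\<omega>. Q p \<omega>}"
      using elim(2) by (intro measure_pmf.finite_measure_mono) auto
    finally show ?case .
  qed
  show "(\<lambda>p. 1 - b p) \<longlonglongrightarrow> 1"
    using tendsto_diff[OF tendsto_const assms(2), of 1] by simp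
qed auto

lemma aas_mono:
  assumes "aas k n P" "\<And>p \<omega>. P p \<omega> \<Longrightarrow> Q p \<omega>"
  shows "aas k n Q"
proof (rule aasI)
  let ?b = "\<lambda>p. measure_pmf.prob (bernoulli_model p (k p) (n p)) (- {\<omega>. P p \<omega>})"
  show "\<forall>\<^sub>F p in sequentially. ?b p \<le> ?b p" by simp
  have "?b p = 1 - measure_pmf.prob (bernoulli_model p (k p) (n p)) {\<omega>. P p \<omega>}" for p
    by (subst measure_pmf.prob_compl[symmetric]) (auto simp: Compl_eq_Diff_UNIV)
  then show "?b \<longlonglongrightarrow> 0"
    using tendsto_diff[OF tendsto_const assms(1)[unfolded aas_def], of 1] by simp
qed (use assms(2) in auto)

text \<open>Reduces the claim to \<open>min \<epsilon> 1\<close>, since a larger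
  \<open>\<epsilon>\<close> leaves fewer levels.\<close>

lemma F_decrement_bound_mono:
  assumes "F_decrement_bound \<epsilon> D k p' m" "\<epsilon> \<le> \<epsilon>'"
  shows "F_decrement_bound \<epsilon>' D k p' m"
proof -
  have "(1 - \<epsilon>') * real k \<le> (1 - \<epsilon>) * real k"
    using assms by (intro mult_right_mono) auto
  then have "levels \<epsilon>' k \<subseteq> levels \<epsilon> k"
    using floor_mono by (fastforce simp: levels_def)
  then show ?thesis
    using assms by (auto simp: F_decrement_bound_def)
qed

text \<open>\<open>D\<close> is fixed before \<open>k\<close> and \<open>n\<close>, so it depends on
  \<open>R\<close> and \<open>\<epsilon>\<close> only. Positivity of the logarithm is carried along
  for the strict decrease.\<close>

lemma aas_F_decrement_bound:
  fixes R \<epsilon> :: real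
  assumes "1 / 2 < R" and "R < 1" and "0 < \<epsilon>"
  obtains D where "0 < D"
    "\<And>k n. fixed_rate_regime R k n \<Longrightarrow>
      aas k n (\<lambda>p \<omega>. F_decrement_bound \<epsilon> D (k p) (p_prime p (n p) \<omega>) (n_pos (n p) \<omega>) \<and>
        0 < ln ((real (p_prime p (n p) \<omega>) - real (k p)) / real (k p)))"
proof -
  define r where "r = 2 * R - 1"
  have r: "0 < r" "r < 1"
    using assms by (auto simp: r_def)
  have \<epsilon>: "0 < min \<epsilon> 1" "min \<epsilon> 1 \<le> 1"
    using assms by auto
  obtain D \<delta>0 K where D: "0 < D" "0 < \<delta>0" "0 < K" and bound:
    "\<And>k p' m A. K \<le> real k \<Longrightarrow> 2 * k \<le> p' \<Longrightarrow> A = real m * (ln 2 / real k) \<Longrightarrow> K \<le> A \<Longrightarrow>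
       \<bar>ln ((real p' - real k) / real k) / A - r\<bar> \<le> \<delta>0 \<Longrightarrow> F_decrement_bound (min \<epsilon> 1) D k p' m"
    using F_decrement_bound_if[OF r \<epsilon>] by blast
  \<comment> \<open>Since \<open>L / A\<close> is within \<open>48 * \<delta>\<close> of
    \<open>r\<close>, the first term meets the tolerance \<open>\<delta>0\<close>, and the last
    keeps \<open>L / A\<close> positive and gives the \<open>\<delta> \<le> r / 8\<close> of
    \<open>expected_count_ge\<close>.\<close>
  define \<delta> where "\<delta> = min (\<delta>0 / 48) (min (1 / 4) (r / 96))"
  have \<delta>: "0 < \<delta>" "\<delta> \<le> 1 / 4" "48 * \<delta> \<le> \<delta>0" "48 * \<delta> \<le> r / 2" "\<delta> \<le> r / 8"
    using D r by (auto simp: \<delta>_def)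
  \<comment> \<open>As a lower bound for \<open>T = ln (p / k)\<close>, the term
    \<open>8 * K\<close> yields \<open>K \<le> T / 8 \<le> A\<close>; the others are the thresholds
    on \<open>T\<close> in the two deterministic estimates.\<close>
  define C where "C = max (8 * K) (max (1 / \<delta>) 2)"
  show thesis
  proof (rule that[OF D(1)])
    fix k n assume regime: "fixed_rate_regime R k n"
    define \<mu> where "\<mu> p \<omega> = (real p - real (k p)) *
        2 powr (- (real (n p) - real (n_pos (n p) \<omega>)) / real (k p))" for p \<omega>
    define Bad where "Bad p = {\<omega>. \<delta> * real (n p) \<le> \<bar>real (n_pos (n p) \<omega>) - real (n p) / 2\<bar> \<or>
           \<mu> p \<omega> / 2 \<le> \<bar>real (p_prime p (n p) \<omega>) - real (k p) - \<mu> p \<omega>\<bar>}" for p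
    note ev = fixed_rate_regime_eventually[OF regime assms(1) \<delta>(1), of C]
    show "aas k n (\<lambda>p \<omega>. F_decrement_bound \<epsilon> D (k p) (p_prime p (n p) \<omega>) (n_pos (n p) \<omega>) \<and>
        0 < ln ((real (p_prime p (n p) \<omega>) - real (k p)) / real (k p)))"
    proof (rule aasI)
      show "\<forall>\<^sub>F p in sequentially. measure_pmf.prob (bernoulli_model p (k p) (n p)) (Bad p)
          \<le> (1 / (2 * \<delta>\<^sup>2) + 8) / real (k p)"
        using ev
      proof eventually_elim
        case (elim p)
        then have k: "0 < k p" "2 * real (k p) \<le> real p" "k p < p"
          by linarith+
        have T: "2 \<le> ln (real p / real (k p))"
          using elim by (auto simp: C_def)
        have *: "real (k p) \<le> real (n p)"
          "real (k p) / 2 \<le> (real p - real (k p)) * 2 powr (- ((1 / 2 + \<delta>) * real (n p)) / real (k p))"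
          using expected_count_ge[where n = "real (n p)", OF assms(1,2) \<delta>(1,2) \<delta>(5)[unfolded r_def] _ k(2) refl T refl] elim by auto
        have "measure_pmf.prob (bernoulli_model p (k p) (n p)) (Bad p)
          \<le> 1 / (2 * \<delta>\<^sup>2 * real (n p)) +
             4 / ((real p - real (k p)) * 2 powr (- ((1 / 2 + \<delta>) * real (n p)) / real (k p)))"
          unfolding Bad_def \<mu>_def using * k \<delta> by (intro bernoulli_model_concentration) auto
        also have "\<dots> \<le> 1 / (2 * \<delta>\<^sup>2 * real (k p)) + 4 / (real (k p) / 2)"
          using * k \<delta> by (intro add_mono divide_left_mono mult_left_mono mult_pos_pos) auto
        also have "\<dots> = (1 / (2 * \<delta>\<^sup>2) + 8) / real (k p)"
          by (simp add: add_divide_distrib)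
        finally show ?case .
      qed
      have "filterlim (\<lambda>p. real (k p)) at_top sequentially"
        using regime by (auto simp: fixed_rate_regime_def intro: filterlim_compose[OF filterlim_real_sequentially])
      then show "(\<lambda>p. (1 / (2 * \<delta>\<^sup>2) + 8) / real (k p)) \<longlonglongrightarrow> 0"
        by (intro real_tendsto_divide_at_top[OF tendsto_const])
      show "\<forall>\<^sub>F p in sequentially. \<forall>\<omega>. \<omega> \<notin> Bad p \<longrightarrow>
          F_decrement_bound \<epsilon> D (k p) (p_prime p (n p) \<omega>) (n_pos (n p) \<omega>) \<and>
          0 < ln ((real (p_prime p (n p) \<omega>) - real (k p)) / real (k p))"
        using ev
      proof (eventually_elim, intro allI impI)
        fix p \<omega>
        assume asm: "C \<le> real (k p) \<and> 0 < k p \<and> 2 * k p \<le> p \<and> C \<le> ln (real p / real (k p)) \<and>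
          \<bar>real (n p) * ln 2 / (real (k p) * ln (real p / real (k p))) - 1 / R\<bar> \<le> \<delta>"
          and "\<omega> \<notin> Bad p"
        then have \<omega>: "\<bar>real (n_pos (n p) \<omega>) - real (n p) / 2\<bar> < \<delta> * real (n p)"
          "\<bar>real (p_prime p (n p) \<omega>) - real (k p) - \<mu> p \<omega>\<bar> < \<mu> p \<omega> / 2"
          by (auto simp: Bad_def)
        define A where "A = real (n_pos (n p) \<omega>) * (ln 2 / real (k p))"
        define L where "L = ln ((real (p_prime p (n p) \<omega>) - real (k p)) / real (k p))"
        have k: "0 < k p" "0 < real (k p)" "2 * real (k p) \<le> real p" "K \<le> real (k p)"
          using asm D by (auto simp: C_def)
        have T: "1 / \<delta> \<le> ln (real p / real (k p))" "8 * K \<le> ln (real p / real (k p))"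
          using asm by (auto simp: C_def)
        note * = decrement_ratio_close[OF assms(1,2) \<delta>(1,2) k(2,3) refl T(1) refl _ \<omega>(1) \<mu>_def \<omega>(2) A_def]
        have A: "K \<le> A" and \<rho>: "\<bar>L / A - r\<bar> \<le> 48 * \<delta>"
          using * asm T by (auto simp: L_def r_def)
        have "0 < L / A"
          using \<rho> \<delta> r by linarith
        then have L: "0 < L"
          using A D by (simp add: zero_less_divide_iff)
        \<comment> \<open>Only for a positive argument is \<open>0 < L\<close> read as a ratio above
          \<open>1\<close>, which gives \<open>2 * k \<le> p'\<close>.\<close>
        have "0 < \<mu> p \<omega>"
          using k by (simp add: \<mu>_def)
        then have "0 < real (p_prime p (n p) \<omega>) - real (k p)"
          using \<omega>(2) by linarith
        then have "1 < (real (p_prime p (n p) \<omega>) - real (k p)) / real (k p)"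
          using L k by (simp add: L_def)
        then have "2 * k p \<le> p_prime p (n p) \<omega>"
          using k by (simp add: field_simps)
        then have "F_decrement_bound (min \<epsilon> 1) D (k p) (p_prime p (n p) \<omega>) (n_pos (n p) \<omega>)"
          using bound[OF k(4) _ A_def A] \<rho> \<delta> by (simp add: L_def)
        then show "F_decrement_bound \<epsilon> D (k p) (p_prime p (n p) \<omega>) (n_pos (n p) \<omega>) \<and>
            0 < ln ((real (p_prime p (n p) \<omega>) - real (k p)) / real (k p))"
          using L F_decrement_bound_mono[of "min \<epsilon> 1" D _ _ _ \<epsilon>] by (simp add: L_def)
      qed
    qed
  qed
qed

theorem theoremB10:
  fixes R \<epsilon> :: real
  assumes "1 / 2 < R" and "R < 1" and "0 < \<epsilon>"
  shows "(\<exists>D>0. \<forall>k n. fixed_rate_regime R k n \<longrightarrow>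
            aas k n (\<lambda>p \<omega>. F_decrement_bound \<epsilon> D (k p) (p_prime p (n p) \<omega>) (n_pos (n p) \<omega>))) \<and>
         (\<forall>k n. fixed_rate_regime R k n \<longrightarrow>
            aas k n (\<lambda>p \<omega>. F_strictly_decreasing \<epsilon> (k p) (p_prime p (n p) \<omega>) (n_pos (n p) \<omega>)))"
proof -
  obtain D where D: "0 < D" and aas: "\<And>k n. fixed_rate_regime R k n \<Longrightarrow>
      aas k n (\<lambda>p \<omega>. F_decrement_bound \<epsilon> D (k p) (p_prime p (n p) \<omega>) (n_pos (n p) \<omega>) \<and>
        0 < ln ((real (p_prime p (n p) \<omega>) - real (k p)) / real (k p)))"
    using aas_F_decrement_bound[OF assms] by blast
  show ?thesis
  proof (intro conjI exI[of _ D] allI impI D)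
    fix k n assume "fixed_rate_regime R k n"
    note aas = aas[OF this]
    show "aas k n (\<lambda>p \<omega>. F_decrement_bound \<epsilon> D (k p) (p_prime p (n p) \<omega>) (n_pos (n p) \<omega>))"
      by (rule aas_mono[OF aas]) simp
    show "aas k n (\<lambda>p \<omega>. F_strictly_decreasing \<epsilon> (k p) (p_prime p (n p) \<omega>) (n_pos (n p) \<omega>))"
      by (rule aas_mono[OF aas]) (use D in \<open>auto intro: F_strictly_decreasing_if\<close>)
  qed
qed

end
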